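(* Let $\mathbb F$ be an algebraically closed field and let $q\in\mathbb F$ be nonzero and not a root of unity. Let $V$ be an evaluation module for $\boxtimes_q$. For $X\in{\rm End}(V)$ the following are equivalent: (i) $X$ is an exchanger for $V$; (ii) for all mutually distinct $i,j,k,\ell$ in $\mathbb Z_4$, $X$ sends each $[i,j,k,\ell]$-basis for $V$ to an $[i+2,j+2,k+2,\ell+2]$-basis for $V$; (iii) there exist mutually distinct $i,j,k,\ell$ in $\mathbb Z_4$ such that $X$ sends the basis $[i,j,k,\ell]$ for $V$ to an $[i+2,j+2,k+2,\ell+2]$-basis for $V$.
   Context: Algebras are associative with 1. $[n]_q=(q^n-q^{-n})/(q-q^{-1})$ and $\mathbb Z_4=\mathbb Z/4\mathbb Z$. The $q$-tetrahedron algebra $\boxtimes_q$ is the $\mathbb F$-algebra with generators (called the standard generators) $\{x_{ij}\mid i,j\in\mathbb Z_4,\ j-i=1\text{ or }j-i=2\}$ and relations: (i) $x_{ij}x_{ji}=1$ if $j-i=2$; (ii) $\frac{qx_{ij}x_{jk}-q^{-1}x_{jk}x_{ij}}{q-q^{-1}}=1$ if $(j-i,k-j)$ is one of $(1,1),(1,2),(2,1)$; (iii) $x_{ij}^3x_{k\ell}-[3]_qx_{ij}^2x_{k\ell}x_{ij}+[3]_qx_{ij}x_{k\ell}x_{ij}^2-x_{k\ell}x_{ij}^3=0$ if $j-i=k-j=\ell-k=1$. Known fact: on a finite-dimensional irreducible $\boxtimes_q$-module $V$ there are $d\in\mathbb N$ (the diameter) and $\varepsilon\in\{1,-1\}$ (the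 type) such that each standard generator is diagonalizable with set of distinct eigenvalues $\{\varepsilon q^{d-2n}\mid 0\le n\le d\}$. Let $V$ have type 1. For distinct $i,j\in\mathbb Z_4$ the decomposition $[i,j]$ of $V$ is the sequence of subspaces $\{V_n\}_{n=0}^d$ (with $V=\bigoplus_n V_n$) such that: if $j-i\in\{1,2\}$, $V_n$ is the eigenspace of $x_{ij}$ with eigenvalue $q^{d-2n}$; if $j-i=3$, $[i,j]$ is the inversion (reversed sequence) of $[j,i]$. The shape $(\dim V_n)_{n=0}^d$ does not depend on $i,j$. For $i\in\mathbb Z_4$ the flag $[i]$ on $V$ has $n$th component $V_0+\cdots+V_n$, where $\{V_n\}$ is the decomposition $[i,j]$; this is known not to depend on $j\ne i$. The trivial $\boxtimes_q$-module is the one-dimensional module on which every standard generator acts as the identity. An evaluation module for $\boxtimes_q$ is a nontrivial finite-dimensional irreducible $\boxtimes_q$-module of type 1 and shape $(1,1,\dots,1)$ (so $d\ge1$, $\dim V=d+1$). For mutually distinct $i,j,k,\ell\in\mathbb Z_4$, an $[i,j,k,\ell]$-basis for $V$ is a basis $\{v_n\}_{n=0}^d$ such that (a) $v_n$ is in component $n$ of the decomposition $[k,\ell]$ for $0\le n\le d$; (b) $\sum_{n=0}^dv_n$ is in component $0$ of the flag $[j]$. Such a basis exists and is unique up to a common nonzero scalar factor. Fix nonzero vectors $\eta_j$ in component $0$ of the flag $[j]$ on $V$ ($j\in\mathbb Z_4$); "the basis $[i,j,k,\ell]$" is the unique $[i,j,k,\ell]$-basis with $\sum_{n=0}^dv_n=\eta_j$.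 An exchanger for $V$ is an invertible $X\in{\rm End}(V)$ such that $Xx_{ij}X^{-1}=x_{i+2,j+2}$ holds on $V$ for each standard generator $x_{ij}$. "$X$ sends a basis $\{v_n\}_{n=0}^d$ to $\{v'_n\}_{n=0}^d$" means $Xv_n=v'_n$ for $0\le n\le d$. *)

theory Defs
  imports
    "HOL-Library.Numeral_Type"
    "HOL-Library.Poly_Mapping"
    "HOL-Algebra.QuotRing"
    "HOL-Algebra.Algebraic_Closure_Type"
begin

(* releases the identifier X, which is wanted for endomorphisms *)
no_notation var (\<open>X\<index>\<close>)

text \<open>
  The integers modulo 4 are the numeral type \<open>4\<close>, whose ring operations are arithmetic modulo 4.
\<close>

datatype 'g free_monoid = Word (letters: "'g list")

text \<open>The free monoid is written additively because the product of \<^theory>\<open>HOL-Library.Poly_Mapping\<close>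
  adds up exponents. Finitely supported functions from it to a field \<open>'f\<close>, with the convolution
  product, are the free \<open>'f\<close>-algebra on \<open>'g\<close>.\<close>

instantiation free_monoid :: (type) monoid_add
begin

definition zero_free_monoid :: "'a free_monoid"
  where "0 = Word []"

definition plus_free_monoid :: "'a free_monoid \<Rightarrow> 'a free_monoid \<Rightarrow> 'a free_monoid"
  where "u + v = Word (letters u @ letters v)"

instance
  by standard (simp_all add: zero_free_monoid_def plus_free_monoid_def)

end

type_synonym ('g, 'f) free_algebra = "'g free_monoid \<Rightarrow>\<^sub>0 'f"

definition free_var :: "'g \<Rightarrow> ('g, 'f::Fields.field) free_algebra"
  where "free_var g = Poly_Mapping.single (Word [g]) 1"

definition free_const :: "'f \<Rightarrow> ('g, 'f::Fields.field) free_algebra"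
  where "free_const c = Poly_Mapping.single 0 c"

definition q_int :: "'f::Fields.field \<Rightarrow> nat \<Rightarrow> 'f"
  where "q_int q n = (q powi int n - q powi (- int n)) / (q - inverse q)"

definition std_index :: "4 \<Rightarrow> 4 \<Rightarrow> bool"
  where "std_index i j \<longleftrightarrow> j - i = 1 \<or> j - i = 2"

typedef std_gen = "{(i, j). std_index i j}"
  by (rule exI[of _ "(0, 1)"]) (simp add: std_index_def)

text \<open>\<open>free_x i j\<close> is only meaningful if \<open>std_index i j\<close>.\<close>

definition free_x :: "4 \<Rightarrow> 4 \<Rightarrow> (std_gen, 'f::Fields.field) free_algebra"
  where "free_x i j = free_var (Abs_std_gen (i, j))"

text \<open>The relations, each given as an element of the free algebra to be set to zero.\<close>

definition qtet_relations :: "'f::Fields.field \<Rightarrow> (std_gen, 'f) free_algebra set"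
  where "qtet_relations q =
    {free_x i j * free_x j i - 1 | i j. j - i = 2} \<union>
    {free_const (inverse (q - inverse q)) *
       (free_const q * free_x i j * free_x j k - free_const (inverse q) * free_x j k * free_x i j) - 1
     | i j k. (j - i, k - j) \<in> {(1, 1), (1, 2), (2, 1)}} \<union>
    {free_x i j ^ 3 * free_x k l
       - free_const (q_int q 3) * free_x i j ^ 2 * free_x k l * free_x i j
       + free_const (q_int q 3) * free_x i j * free_x k l * free_x i j ^ 2
       - free_x k l * free_x i j ^ 3
     | i j k l. j - i = 1 \<and> k - j = 1 \<and> l - k = 1}"

definition qtet_ideal :: "'f::Fields.field \<Rightarrow> (std_gen, 'f) free_algebra set"
  where "qtet_ideal q = Idl\<^bsub>ring_of_type_algebra\<^esub> (qtet_relations q)"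

definition qtet_algebra :: "'f::Fields.field \<Rightarrow> (std_gen, 'f) free_algebra set ring"
  where "qtet_algebra q = ring_of_type_algebra Quot (qtet_ideal q)"

definition qtet_class ::
    "'f::Fields.field \<Rightarrow> (std_gen, 'f) free_algebra \<Rightarrow> (std_gen, 'f) free_algebra set"
  where "qtet_class q a = qtet_ideal q +>\<^bsub>ring_of_type_algebra\<^esub> a"

text \<open>The underlying vector space is the whole type \<open>'v\<close>, with scalar multiplication \<open>scale\<close>.\<close>

locale qtet_module = vector_space scale
  for scale :: "'f::Fields.field \<Rightarrow> 'v::ab_group_add \<Rightarrow> 'v" (infixr \<open>*s\<close> 75) +
  fixes q :: 'f
    and act :: "(std_gen, 'f) free_algebra set \<Rightarrow> 'v \<Rightarrow> 'v"
  assumes act_linear: "a \<in> carrier (qtet_algebra q) \<Longrightarrow> Vector_Spaces.linear scale scale (act a)"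
    and act_one: "act \<one>\<^bsub>qtet_algebra q\<^esub> = id"
    and act_mult: "\<lbrakk>a \<in> carrier (qtet_algebra q); b \<in> carrier (qtet_algebra q)\<rbrakk>
      \<Longrightarrow> act (a \<otimes>\<^bsub>qtet_algebra q\<^esub> b) = act a \<circ> act b"
    and act_add: "\<lbrakk>a \<in> carrier (qtet_algebra q); b \<in> carrier (qtet_algebra q)\<rbrakk>
      \<Longrightarrow> act (a \<oplus>\<^bsub>qtet_algebra q\<^esub> b) v = act a v + act b v"
    and act_const: "act (qtet_class q (free_const c)) v = c *s v"
begin

definition gen_act :: "4 \<Rightarrow> 4 \<Rightarrow> 'v \<Rightarrow> 'v"
  where "gen_act i j = act (qtet_class q (free_x i j))"

definition finite_dimensional :: bool
  where "finite_dimensional \<longleftrightarrow> (\<exists>B. finite B \<and> span B = UNIV)"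

definition irreducible_module :: bool
  where "irreducible_module \<longleftrightarrow> (UNIV :: 'v set) \<noteq> {0} \<and>
    (\<forall>W. subspace W \<and> (\<forall>a\<in>carrier (qtet_algebra q). act a ` W \<subseteq> W) \<longrightarrow> W = {0} \<or> W = UNIV)"

definition trivial_module :: bool
  where "trivial_module \<longleftrightarrow> dim (UNIV :: 'v set) = 1 \<and> (\<forall>i j. std_index i j \<longrightarrow> gen_act i j = id)"

definition eigenspace :: "('v \<Rightarrow> 'v) \<Rightarrow> 'f \<Rightarrow> 'v set"
  where "eigenspace T c = {v. T v = c *s v}"

definition eigenvalues :: "('v \<Rightarrow> 'v) \<Rightarrow> 'f set"
  where "eigenvalues T = {c. \<exists>v. v \<noteq> 0 \<and> T v = c *s v}"

definition diagonalizable :: "('v \<Rightarrow> 'v) \<Rightarrow> bool"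
  where "diagonalizable T \<longleftrightarrow>
    (\<exists>B. independent B \<and> span B = UNIV \<and> (\<forall>b\<in>B. \<exists>c. T b = c *s b))"

definition has_diameter_type :: "nat \<Rightarrow> 'f \<Rightarrow> bool"
  where "has_diameter_type d \<epsilon> \<longleftrightarrow> \<epsilon> \<in> {1, -1} \<and>
    (\<forall>i j. std_index i j \<longrightarrow> diagonalizable (gen_act i j) \<and>
      eigenvalues (gen_act i j) = {\<epsilon> * q powi (int d - 2 * int n) | n. n \<le> d})"

definition diameter :: nat
  where "diameter = (THE d. \<exists>\<epsilon>. has_diameter_type d \<epsilon>)"

text \<open>Component \<open>n\<close> of the decomposition \<open>[i,j]\<close>, for \<open>i \<noteq> j\<close> and \<open>n \<le> diameter\<close> and a module
  of type 1. The last branch is the inversion of \<open>[j,i]\<close> in the case \<open>j - i = 3\<close>.\<close>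

definition decomp :: "4 \<Rightarrow> 4 \<Rightarrow> nat \<Rightarrow> 'v set"
  where "decomp i j n =
    (if std_index i j then eigenspace (gen_act i j) (q powi (int diameter - 2 * int n))
     else eigenspace (gen_act j i) (q powi (int diameter - 2 * int (diameter - n))))"

definition shape :: "4 \<Rightarrow> 4 \<Rightarrow> nat list"
  where "shape i j = map (\<lambda>n. dim (decomp i j n)) [0..<diameter + 1]"

text \<open>The flag \<open>[i]\<close> may be computed from the decomposition \<open>[i,j]\<close> for any \<open>j \<noteq> i\<close>; the definition
  takes \<open>j = i + 1\<close>.\<close>

definition flag :: "4 \<Rightarrow> nat \<Rightarrow> 'v set"
  where "flag i n = span (\<Union>m\<le>n. decomp i (i + 1) m)"

text \<open>A basis \<open>(v\<^sub>n)\<close> with \<open>0 \<le> n \<le> d\<close> is a list of length \<open>d + 1\<close>. The index \<open>i\<close> is the element of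
  \<open>\<int>/4\<int>\<close> different from \<open>j\<close>, \<open>k\<close>, \<open>l\<close>.\<close>

definition ijkl_basis :: "4 \<Rightarrow> 4 \<Rightarrow> 4 \<Rightarrow> 4 \<Rightarrow> 'v list \<Rightarrow> bool"
  where "ijkl_basis i j k l vs \<longleftrightarrow>
    distinct [i, j, k, l] \<and>
    length vs = diameter + 1 \<and> distinct vs \<and> independent (set vs) \<and> span (set vs) = UNIV \<and>
    (\<forall>n\<le>diameter. vs ! n \<in> decomp k l n) \<and>
    (\<Sum>n\<le>diameter. vs ! n) \<in> flag j 0"

definition the_basis :: "(4 \<Rightarrow> 'v) \<Rightarrow> 4 \<Rightarrow> 4 \<Rightarrow> 4 \<Rightarrow> 4 \<Rightarrow> 'v list"
  where "the_basis \<eta> i j k l = (THE vs. ijkl_basis i j k l vs \<and> (\<Sum>n\<le>diameter. vs ! n) = \<eta> j)"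

definition exchanger :: "('v \<Rightarrow> 'v) \<Rightarrow> bool"
  where "exchanger X \<longleftrightarrow> Vector_Spaces.linear scale scale X \<and> bij X \<and>
    (\<forall>i j. std_index i j \<longrightarrow> X \<circ> gen_act i j \<circ> inv_into UNIV X = gen_act (i + 2) (j + 2))"

end

locale evaluation_module = qtet_module +
  assumes finite_dim: finite_dimensional
    and irreducible: irreducible_module
    and type_1: "has_diameter_type diameter 1"
    and nontrivial: "\<not> trivial_module"
    and shape_ones: "i \<noteq> j \<Longrightarrow> shape i j = replicate (diameter + 1) 1"

end

theory Submission
  imports Defs
begin

text \<open>
  The theorem rests on one existence statement: an evaluation module has an exchanger \<open>Y\<close>. The
  rest is mainly uniqueness. An exchanger carries the decomposition \<open>[k,l]\<close> to \<open>[k+2,l+2]\<close>,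
  hence \<open>[i,j,k,l]\<close>-bases to \<open>[i+2,j+2,k+2,l+2]\<close>-bases. A basis of either kind is unique up to
  one scalar factor, because the components of the decompositions are lines. So if a linear map
  \<open>X\<close> sends a single \<open>[i,j,k,l]\<close>-basis to an \<open>[i+2,j+2,k+2,l+2]\<close>-basis, then \<open>X\<close> and a nonzero
  multiple of \<open>Y\<close> agree on that basis, and \<open>X\<close> is an exchanger (\<open>exchangerI_basis\<close>). That there
  are bases to which this applies follows from an eigenvector without vanishing coordinates
  (\<open>ijkl_basis_exists\<close>) and, where only the antipodal basis is given, by mapping it back with
  \<open>Y\<close> (\<open>ijkl_basis_exists_antipodal\<close>).

  To construct \<open>Y\<close>, fix \<open>i\<close> and let \<open>D\<close>, \<open>A\<close>, \<open>B\<close>, \<open>C\<close>, \<open>E\<close>, \<open>F\<close> be the actions of the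
  generators with the indices \<open>(i,i+1)\<close>, \<open>(i+1,i+2)\<close>, \<open>(i+1,i+3)\<close>, \<open>(i+2,i)\<close>, \<open>(i+3,i)\<close>,
  \<open>(i+2,i+3)\<close>. Let \<open>v n\<close> be an eigenvector of \<open>D\<close> for \<open>\<theta> n = q\<^bsup>d-2n\<^esup>\<close>. The quadratic
  relations make \<open>A\<close> and \<open>B\<close> raise and \<open>C\<close> and \<open>E\<close> lower: apart from a multiple of \<open>v n\<close>, the
  images of \<open>v n\<close> are multiples of \<open>v (n+1)\<close> and \<open>v (n-1)\<close>, respectively. Let \<open>a n\<close>, \<open>b n\<close>,
  \<open>c n\<close>, \<open>e n\<close> be the coefficients of \<open>A\<close>, \<open>B\<close>, \<open>C\<close>, \<open>E\<close> for the steps between \<open>v n\<close> and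
  \<open>v (n+1)\<close>.

  \<^item> \<open>a n * c n = b n * e n = \<phi> n\<close>, where \<open>\<phi> n\<close> depends only on \<open>q\<close>, \<open>d\<close>, \<open>n\<close> and
    is nonzero for \<open>n < d\<close> (\<open>raise_lower_product\<close>).
  \<^item> Since \<open>B\<close> is inverse to the generator \<open>(i+3,i+1)\<close>, the relation between that generator and
    \<open>A\<close> becomes a recursion for \<open>a n / b n\<close>, whose solutions are \<open>1 - \<tau> * \<theta> n\<close>. So
    \<open>A = B + \<tau> (1 - B D)\<close> for a scalar \<open>\<tau> = \<tau>\<^sub>i\<close>, which plays the role of the
    evaluation parameter (\<open>raises_ratio\<close>, \<open>raises_affine\<close>).
  \<^item> The same identity for \<open>i+1\<close> is \<open>F = C + \<sigma> (1 - C A)\<close>, and the relation between \<open>F\<close>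
    and the inverse of \<open>B\<close>, tested on \<open>v d\<close>, yields \<open>\<tau> * \<sigma> * q\<^sup>2 = 1\<close>
    (\<open>parameter_product\<close>). Applying this for \<open>i\<close> and for \<open>i+1\<close> shows that \<open>i\<close> and \<open>i+2\<close> have the
    same parameter.

  Now scale the eigenbasis such that \<open>b n = 1\<close>. The matrices of \<open>D\<close>, \<open>B\<close>, \<open>C\<close> then depend
  only on \<open>q\<close>, \<open>d\<close>, \<open>\<tau>\<close>, so the linear map from the basis for \<open>i\<close> to the basis for \<open>i+2\<close>
  intertwines these generators with their shifts by 2. The diagonal generators are inverse in
  pairs, and the remaining generators are expressed through the earlier ones by the identities
  with \<open>\<tau>\<close> and \<open>\<sigma>\<close>. This map is \<open>Y\<close> (\<open>antipodal_intertwiner\<close>).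
\<close>

section \<open>Indices modulo 4\<close>

lemma mod4_cases: "(i::4) = 0 \<or> i = 1 \<or> i = 2 \<or> i = 3"
proof (cases i)
  case (of_int z)
  then have "z = 0 \<or> z = 1 \<or> z = 2 \<or> z = 3" by auto
  then show ?thesis using of_int by auto
qed

lemma mod4_add:
  fixes i :: 4
  shows "i + 1 + 1 = i + 2" "i + 1 + 2 = i + 3" "i + 1 + 3 = i"
    "i + 2 + 1 = i + 3" "i + 2 + 2 = i" "i + 2 + 3 = i + 1"
    "i + 3 + 1 = i" "i + 3 + 2 = i + 1" "i + 3 + 3 = i + 2"
  using mod4_cases[of i] by auto

lemma std_index_add2: "std_index (i+2) (j+2) = std_index i j"
  unfolding std_index_def by simp

lemma std_index_flip: "i \<noteq> j \<Longrightarrow> \<not> std_index i j \<Longrightarrow> std_index j i"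
  unfolding std_index_def using mod4_cases[of i] mod4_cases[of j] by auto

section \<open>The relations on a module\<close>

lemma ring_of_type_algebra_ring: "ring (ring_of_type_algebra :: 'a::ring_1 ring)"
proof -
  have "\<exists>y. y + x = 0 \<and> x + y = 0" for x :: 'a
    by (rule exI[of _ "- x"]) simp
  then show ?thesis
    unfolding ring_of_type_algebra_def
    by unfold_locales (auto simp: algebra_simps Units_def)
qed

lemma ideal_qtet:
  fixes q :: "'f::Fields.field"
  shows "ideal (qtet_ideal q) ring_of_type_algebra"
proof -
  interpret ring "ring_of_type_algebra :: (std_gen, 'f::Fields.field) free_algebra ring"
    by (rule ring_of_type_algebra_ring)
  show ?thesis unfolding qtet_ideal_def
    by (rule genideal_ideal) (simp add: ring_of_type_algebra_def)
qed

lemma qtet_class_relation: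
  fixes q :: "'f::Fields.field"
  assumes "r \<in> qtet_relations q"
  shows "qtet_class q r = qtet_class q 0"
proof -
  interpret ring "ring_of_type_algebra :: (std_gen, 'f::Fields.field) free_algebra ring"
    by (rule ring_of_type_algebra_ring)
  interpret I: ideal "qtet_ideal q" ring_of_type_algebra by (rule ideal_qtet)
  have "r \<in> qtet_ideal q" unfolding qtet_ideal_def
    using genideal_self[of "qtet_relations q"] assms by (auto simp: ring_of_type_algebra_def)
  then show ?thesis
    unfolding qtet_class_def using I.a_rcos_const[of r] I.a_rcos_const[of 0] I.zero_closed
    by (simp add: ring_of_type_algebra_def)
qed

context qtet_module
begin

text \<open>Pulling the action back to the free algebra avoids cosets: every defining relation
  becomes an equation between endomorphisms.\<close>

definition free_act :: "(std_gen, 'f) free_algebra \<Rightarrow> 'v \<Rightarrow> 'v"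
  where "free_act a = act (qtet_class q a)"

lemma qtet_class_hom: "qtet_class q \<in> ring_hom ring_of_type_algebra (qtet_algebra q)"
  unfolding qtet_class_def[abs_def] qtet_algebra_def
  by (rule ideal.rcos_ring_hom[OF ideal_qtet])

lemma free_act_linear: "Vector_Spaces.linear scale scale (free_act a)"
  unfolding free_act_def
  by (rule act_linear, rule ring_hom_closed[OF qtet_class_hom])
    (simp add: ring_of_type_algebra_def)

lemma qtet_class_carrier: "qtet_class q a \<in> carrier (qtet_algebra q)"
  by (rule ring_hom_closed[OF qtet_class_hom]) (simp add: ring_of_type_algebra_def)

lemma free_act_mult: "free_act (a * b) v = free_act a (free_act b v)"
  using ring_hom_mult[OF qtet_class_hom, of a b]
    act_mult[OF qtet_class_carrier qtet_class_carrier, of a b]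
  by (simp add: ring_of_type_algebra_def free_act_def)

lemma free_act_add: "free_act (a + b) v = free_act a v + free_act b v"
  using ring_hom_add[OF qtet_class_hom, of a b]
    act_add[OF qtet_class_carrier qtet_class_carrier, of a b]
  by (simp add: ring_of_type_algebra_def free_act_def)

lemma free_act_const: "free_act (free_const c) v = c *s v"
  by (simp add: free_act_def act_const)

lemma free_act_0: "free_act 0 v = 0"
  using free_act_const[of 0 v] by (simp add: free_const_def)

lemma free_act_1: "free_act 1 v = v"
  using free_act_const[of 1 v] by (simp add: free_const_def)

lemma free_act_diff: "free_act (a - b) v = free_act a v - free_act b v"
  using free_act_add[of "a - b" b v] by simp

lemma free_act_relation: "r \<in> qtet_relations q \<Longrightarrow> free_act r v = 0"
  using qtet_class_relation[of r q] free_act_0[of v] by (simp add: free_act_def)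

lemma gen_act_free_act: "gen_act i j = free_act (free_x i j)"
  by (simp add: gen_act_def free_act_def)

lemma gen_act_linear: "Vector_Spaces.linear scale scale (gen_act i j)"
  by (simp add: gen_act_free_act free_act_linear)

lemma gen_act_inverse:
  assumes "j - i = 2"
  shows "gen_act i j (gen_act j i v) = v"
proof -
  have "free_x i j * free_x j i - 1 \<in> qtet_relations q"
    using assms unfolding qtet_relations_def by blast
  from free_act_relation[OF this, of v] show ?thesis
    by (simp add: free_act_diff free_act_mult free_act_1 gen_act_free_act)
qed

lemma gen_act_weyl:
  assumes "(j - i, k - j) \<in> {(1, 1), (1, 2), (2, 1)}" "q - inverse q \<noteq> 0"
  shows "q *s gen_act i j (gen_act j k v) - inverse q *s gen_act j k (gen_act i j v) =
    (q - inverse q) *s v" (is "?L = _")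
proof -
  have "free_const (inverse (q - inverse q)) *
       (free_const q * free_x i j * free_x j k
          - free_const (inverse q) * free_x j k * free_x i j) - 1
     \<in> qtet_relations q"
    using assms(1) unfolding qtet_relations_def by blast
  from free_act_relation[OF this, of v] have "inverse (q - inverse q) *s ?L = v"
    by (simp add: free_act_diff free_act_mult free_act_1 gen_act_free_act free_act_const)
  then have "(q - inverse q) *s (inverse (q - inverse q) *s ?L) = (q - inverse q) *s v" by simp
  then show ?thesis using assms(2) by simp
qed

end

section \<open>Weight bases and q-Weyl pairs\<close>

text \<open>Induction on the number of eigenvalues: applying \<open>T - c m\<close> kills the \<open>m\<close>th summand and
  rescales the others by nonzero factors.\<close>

lemma (in vector_space) eigenvectors_sum_zero:
  assumes "finite N" "Vector_Spaces.linear scale scale T" "inj_on c N"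
    and "\<And>n. n \<in> N \<Longrightarrow> T (u n) = scale (c n) (u n)" "(\<Sum>n\<in>N. u n) = 0" "n \<in> N"
  shows "u n = 0"
  using assms(1,3-)
proof (induction N arbitrary: u n rule: finite_induct)
  case empty
  then show ?case by simp
next
  case (insert m N)
  interpret T: Vector_Spaces.linear scale scale T by fact
  have sum: "u m + (\<Sum>n\<in>N. u n) = 0" using insert by simp
  then have "T (u m + (\<Sum>n\<in>N. u n)) = scale (c m) (u m + (\<Sum>n\<in>N. u n))"
    by (simp add: T.zero)
  then have "(\<Sum>n\<in>N. scale (c n) (u n)) = (\<Sum>n\<in>N. scale (c m) (u n))"
    using insert.prems(2) insert.hyps
    by (simp add: T.add T.sum scale_right_distrib scale_sum_right cong: sum.cong)
  then have 0: "(\<Sum>n\<in>N. scale (c n - c m) (u n)) = 0"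
    by (simp add: scale_left_diff_distrib sum_subtractf)
  have *: "u k = 0" if "k \<in> N" for k
  proof -
    have "scale (c k - c m) (u k) = 0"
      using insert.prems(1,2) that
      by (intro insert.IH[of "\<lambda>n. scale (c n - c m) (u n)"])
        (auto simp: T.scale 0 mult.commute intro: inj_on_subset)
    moreover have "c k \<noteq> c m" using insert.prems(1) insert.hyps that by (auto simp: inj_on_def)
    ultimately show ?thesis by simp
  qed
  then have "u m = 0" using sum by simp
  then show ?case using * insert.prems by auto
qed

definition (in vector_space) weyl_pair :: "'a \<Rightarrow> ('b \<Rightarrow> 'b) \<Rightarrow> ('b \<Rightarrow> 'b) \<Rightarrow> bool"
  where "weyl_pair q S T \<longleftrightarrow>
    (\<forall>u. scale q (S (T u)) - scale (inverse q) (T (S u)) = scale (q - inverse q) u)"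

text \<open>The eigenvalues \<open>q\<^bsup>d-2n\<^esup>\<close> are written with natural exponents. Since \<open>q\<close> is not a root
  of unity they are distinct, so \<open>D\<close> has the \<open>d+1\<close> lines spanned by the \<open>v n\<close> as its
  eigenspaces.\<close>

locale weight_basis = vector_space scale
  for scale :: "'f::Fields.field \<Rightarrow> 'v::ab_group_add \<Rightarrow> 'v" (infixr \<open>*s\<close> 75) +
  fixes q :: 'f and d :: nat and D :: "'v \<Rightarrow> 'v" and v :: "nat \<Rightarrow> 'v"
  assumes q_nonzero: "q \<noteq> 0"
    and q_not_root: "\<And>n. n > 0 \<Longrightarrow> q ^ n \<noteq> 1"
    and linear_D: "Vector_Spaces.linear scale scale D"
    and D_v: "\<And>n. n \<le> d \<Longrightarrow> D (v n) = (q ^ d / q ^ (2 * n)) *s v n"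
    and v_nonzero: "\<And>n. n \<le> d \<Longrightarrow> v n \<noteq> 0"
    and span_v: "span (v ` {..d}) = UNIV"
begin

definition \<theta> :: "nat \<Rightarrow> 'f" where "\<theta> n = q ^ d / q ^ (2 * n)"

abbreviation endo :: "('v \<Rightarrow> 'v) \<Rightarrow> bool" where "endo \<equiv> Vector_Spaces.linear scale scale"

lemma D_\<theta>: "n \<le> d \<Longrightarrow> D (v n) = \<theta> n *s v n"
  by (simp add: \<theta>_def D_v)

lemma \<theta>_nonzero [simp]: "\<theta> n \<noteq> 0"
  using q_nonzero by (simp add: \<theta>_def)

lemma \<theta>_Suc: "\<theta> (Suc n) = \<theta> n / q\<^sup>2"
  by (simp add: \<theta>_def power2_eq_square)

lemma q_pow_inj: "q ^ m = q ^ n \<longleftrightarrow> m = n"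
proof -
  have "m = n" if "q ^ m = q ^ n" "m \<le> n" for m n
  proof -
    have "q ^ n = q ^ m * q ^ (n - m)" using that(2) by (simp flip: power_add)
    then have "q ^ (n - m) = 1" using that(1) q_nonzero by simp
    then have "n - m = 0" using q_not_root[of "n - m"] by (cases "n - m") auto
    then show ?thesis using that(2) by simp
  qed
  then show ?thesis by (metis nat_le_linear)
qed

lemma \<theta>_inj: "\<theta> m = \<theta> n \<longleftrightarrow> m = n"
proof -
  have "\<theta> m = \<theta> n \<longleftrightarrow> q ^ (2 * n) = q ^ (2 * m)"
    using q_nonzero by (simp add: \<theta>_def divide_simps mult.commute)
  then show ?thesis by (auto simp: q_pow_inj)
qed

lemma span_coeffs: "\<exists>k. u = (\<Sum>n\<le>d. k n *s v n)"
proof -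
  have "u \<in> span (v ` {..d})" using span_v by simp
  then show ?thesis
  proof (induction rule: span_induct_alt)
    case base
    show ?case by (rule exI[of _ "\<lambda>_. 0"]) simp
  next
    case (step c x y)
    then obtain k m where "y = (\<Sum>n\<le>d. k n *s v n)" "x = v m" "m \<le> d" by auto
    then have "c *s x + y = (\<Sum>n\<le>d. (k n + (if n = m then c else 0)) *s v n)"
      by (simp add: scale_left_distrib sum.distrib if_distrib[of "\<lambda>a. a *s _"] sum.delta
        cong: if_cong)
    then show ?case by (rule exI[of _ "\<lambda>n. k n + (if n = m then c else 0)"])
  qed
qed

lemma \<theta>_inj_on: "inj_on \<theta> N"
  by (auto simp: inj_on_def \<theta>_inj)

lemma coeffs_zero:
  assumes "(\<Sum>n\<le>d. k n *s v n) = 0" "n \<le> d"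
  shows "k n = 0"
proof -
  interpret D: Vector_Spaces.linear scale scale D by (rule linear_D)
  have "k n *s v n = 0"
    by (rule eigenvectors_sum_zero[OF _ linear_D \<theta>_inj_on _ assms(1)])
      (use assms(2) in \<open>auto simp: D.scale D_\<theta> mult.commute\<close>)
  then show ?thesis using v_nonzero assms(2) by simp
qed

lemma eigenvector_D:
  assumes "D u = c *s u"
  shows "m \<le> d \<Longrightarrow> c = \<theta> m \<Longrightarrow> \<exists>k. u = k *s v m"
    and "(\<And>n. n \<le> d \<Longrightarrow> c \<noteq> \<theta> n) \<Longrightarrow> u = 0"
proof -
  interpret D: Vector_Spaces.linear scale scale D by (rule linear_D)
  obtain k where k: "u = (\<Sum>n\<le>d. k n *s v n)" using span_coeffs by blast
  have "(\<Sum>n\<le>d. (k n * (\<theta> n - c)) *s v n) = 0"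
    using assms unfolding k
    by (simp add: D.sum D.scale D_\<theta> scale_sum_right right_diff_distrib scale_left_diff_distrib
        sum_subtractf mult.commute)
  then have *: "k n * (\<theta> n - c) = 0" if "n \<le> d" for n
    using coeffs_zero[of "\<lambda>n. k n * (\<theta> n - c)"] that by simp
  show "\<exists>k. u = k *s v m" if "m \<le> d" "c = \<theta> m"
  proof -
    have "k n = 0" if "n \<le> d" "n \<noteq> m" for n
      using *[of n] that \<open>c = _\<close> \<theta>_inj[of n m] by simp
    then have "u = (\<Sum>n\<le>d. if n = m then k n *s v n else 0)"
      unfolding k by (intro sum.cong) auto
    then show ?thesis using \<open>m \<le> d\<close> by (auto simp: sum.delta)
  qed
  show "u = 0" if "\<And>n. n \<le> d \<Longrightarrow> c \<noteq> \<theta> n"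
    using * that unfolding k by (force intro!: sum.neutral)
qed

lemma two_coeffs_unique:
  assumes "\<alpha> *s v m + \<beta> *s v n = \<alpha>' *s v m + \<beta>' *s v n" "m \<le> d" "n \<le> d" "m \<noteq> n"
  shows "\<alpha> = \<alpha>'" "\<beta> = \<beta>'"
proof -
  interpret D: Vector_Spaces.linear scale scale D by (rule linear_D)
  have *: "(\<Sum>i\<in>{m,n}. (if i = m then \<alpha> - \<alpha>' else \<beta> - \<beta>') *s v i) = 0"
    using assms by (simp add: scale_left_diff_distrib algebra_simps)
  have "(if i = m then \<alpha> - \<alpha>' else \<beta> - \<beta>') *s v i = 0" if "i \<in> {m,n}" for i
    by (rule eigenvectors_sum_zero[OF _ linear_D \<theta>_inj_on _ * that])
      (use assms(2,3) in \<open>auto simp: D.scale D_\<theta> mult.commute\<close>)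
  from this[of m] this[of n] assms show "\<alpha> = \<alpha>'" "\<beta> = \<beta>'" using v_nonzero by auto
qed

lemma three_coeffs_zero:
  assumes "\<alpha> *s v (Suc (Suc n)) + \<beta> *s v (Suc n) + \<gamma> *s v n = 0" "Suc (Suc n) \<le> d"
  shows "\<alpha> = 0" "\<beta> = 0"
proof -
  interpret D: Vector_Spaces.linear scale scale D by (rule linear_D)
  let ?k = "\<lambda>i. if i = n then \<gamma> else if i = Suc n then \<beta> else \<alpha>"
  have *: "(\<Sum>i\<in>{n,Suc n,Suc (Suc n)}. ?k i *s v i) = 0"
    using assms by (simp add: algebra_simps)
  have "?k i *s v i = 0" if "i \<in> {n,Suc n,Suc (Suc n)}" for i
    by (rule eigenvectors_sum_zero[OF _ linear_D \<theta>_inj_on _ * that])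
      (use assms(2) in \<open>auto simp: D.scale D_\<theta> mult.commute\<close>)
  from this[of "Suc n"] this[of "Suc (Suc n)"] show "\<alpha> = 0" "\<beta> = 0"
    using v_nonzero assms(2) by auto
qed

lemma endo_eqI:
  assumes "endo S" "endo T" "\<And>n. n \<le> d \<Longrightarrow> S (v n) = T (v n)"
  shows "S u = T u"
proof -
  interpret S: Vector_Spaces.linear scale scale S by fact
  interpret T: Vector_Spaces.linear scale scale T by fact
  obtain k where k: "u = (\<Sum>n\<le>d. k n *s v n)" using span_coeffs by blast
  show ?thesis unfolding k by (simp add: S.sum S.scale T.sum T.scale assms(3))
qed

text \<open>A raising operator is lower bidiagonal in the basis, a lowering operator is upper
  bidiagonal; the diagonal entries \<open>1 / \<theta> n\<close> are the ones that the q-Weyl relation with \<open>D\<close>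
  forces. The coefficient with index \<open>n\<close> always belongs to the step between \<open>v n\<close> and
  \<open>v (n+1)\<close>, so that coefficients of a raising and a lowering operator with the same index can
  be multiplied.\<close>

definition raises :: "('v \<Rightarrow> 'v) \<Rightarrow> (nat \<Rightarrow> 'f) \<Rightarrow> bool"
  where "raises A a \<longleftrightarrow> (\<forall>n<d. A (v n) = (1 / \<theta> n) *s v n + a n *s v (Suc n)) \<and>
    A (v d) = (1 / \<theta> d) *s v d"

definition lowers :: "('v \<Rightarrow> 'v) \<Rightarrow> (nat \<Rightarrow> 'f) \<Rightarrow> bool"
  where "lowers C c \<longleftrightarrow> (\<forall>n<d. C (v (Suc n)) = (1 / \<theta> (Suc n)) *s v (Suc n) + c n *s v n) \<and>
    C (v 0) = (1 / \<theta> 0) *s v 0"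

lemma scale_eqD: "a *s x = y \<Longrightarrow> a \<noteq> 0 \<Longrightarrow> x = inverse a *s y"
  by auto

text \<open>The q-Weyl relation applied to an eigenvector is an inhomogeneous eigenvector equation
  for \<open>A (v n)\<close> with particular solution \<open>(1 / \<theta> n) *s v n\<close>. The difference is a solution
  of the homogeneous equation for the neighbouring eigenvalue.\<close>

lemma weyl_pair_raises:
  assumes "endo A" "weyl_pair q D A" "n \<le> d"
  shows "D (A (v n) - (1 / \<theta> n) *s v n) = (\<theta> n / q^2) *s (A (v n) - (1 / \<theta> n) *s v n)"
proof -
  interpret D: Vector_Spaces.linear scale scale D by (rule linear_D)
  interpret A: Vector_Spaces.linear scale scale A by fact
  have "q *s D (A (v n)) - inverse q *s A (D (v n)) = (q - inverse q) *s v n"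
    using assms(2) by (simp add: weyl_pair_def)
  then have "q *s D (A (v n)) = (inverse q * \<theta> n) *s A (v n) + (q - inverse q) *s v n"
    by (simp add: D_\<theta> assms(3) A.scale algebra_simps)
  from scale_eqD[OF this q_nonzero]
  have "D (A (v n)) = (\<theta> n / q^2) *s A (v n) + (1 - 1 / q^2) *s v n"
    using q_nonzero by (simp add: scale_right_distrib power2_eq_square field_simps)
  then show ?thesis using q_nonzero
    by (simp add: D.diff D.scale D_\<theta> assms(3) scale_right_diff_distrib scale_left_diff_distrib)
qed

lemma weyl_pair_lowers:
  assumes "endo A" "weyl_pair q A D" "n \<le> d"
  shows "D (A (v n) - (1 / \<theta> n) *s v n) = (\<theta> n * q^2) *s (A (v n) - (1 / \<theta> n) *s v n)"
proof -
  interpret D: Vector_Spaces.linear scale scale D by (rule linear_D)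
  interpret A: Vector_Spaces.linear scale scale A by fact
  have "q *s A (D (v n)) - inverse q *s D (A (v n)) = (q - inverse q) *s v n"
    using assms(2) by (simp add: weyl_pair_def)
  then have "inverse q *s D (A (v n)) = (q * \<theta> n) *s A (v n) + (inverse q - q) *s v n"
    by (simp add: D_\<theta> assms(3) A.scale algebra_simps)
  moreover have "q * (inverse q - q) = 1 - q\<^sup>2"
    using q_nonzero by (simp add: right_diff_distrib power2_eq_square)
  ultimately have "D (A (v n)) = (\<theta> n * q^2) *s A (v n) + (1 - q^2) *s v n"
    using scale_eqD[of "inverse q" "D (A (v n))"] q_nonzero
    by (simp add: scale_right_distrib power2_eq_square mult_ac)
  then show ?thesis using q_nonzero
    by (simp add: D.diff D.scale D_\<theta> assms(3) scale_right_diff_distrib scale_left_diff_distrib)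
qed

lemma raises_exists:
  assumes "endo A" "weyl_pair q D A"
  shows "\<exists>a. raises A a"
proof -
  have "\<exists>k. A (v n) = (1 / \<theta> n) *s v n + k *s v (Suc n)" if "n < d" for n
  proof -
    have "\<theta> n / q\<^sup>2 = \<theta> (Suc n)" by (simp add: \<theta>_Suc)
    from eigenvector_D(1)[OF weyl_pair_raises[OF assms], of n "Suc n", OF _ _ this] that
    obtain k where "A (v n) - (1 / \<theta> n) *s v n = k *s v (Suc n)" by auto
    then show ?thesis by (auto simp: algebra_simps)
  qed
  then obtain a where "\<forall>n<d. A (v n) = (1 / \<theta> n) *s v n + a n *s v (Suc n)" by metis
  moreover have "A (v d) = (1 / \<theta> d) *s v d"
  proof -
    have "\<theta> d / q\<^sup>2 \<noteq> \<theta> n" if "n \<le> d" for n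
    proof -
      have "\<theta> d / q\<^sup>2 = \<theta> (Suc d)" by (simp add: \<theta>_Suc)
      then show ?thesis using \<theta>_inj[of "Suc d" n] that by auto
    qed
    from eigenvector_D(2)[OF weyl_pair_raises[OF assms], of d, OF _ this] show ?thesis by simp
  qed
  ultimately show ?thesis unfolding raises_def by blast
qed

lemma lowers_exists:
  assumes "endo A" "weyl_pair q A D"
  shows "\<exists>a. lowers A a"
proof -
  have "\<exists>k. A (v (Suc n)) = (1 / \<theta> (Suc n)) *s v (Suc n) + k *s v n" if "n < d" for n
  proof -
    have "\<theta> (Suc n) * q\<^sup>2 = \<theta> n" using q_nonzero by (simp add: \<theta>_Suc)
    from eigenvector_D(1)[OF weyl_pair_lowers[OF assms], of "Suc n" "n", OF _ _ this] that
    obtain k where "A (v (Suc n)) - (1 / \<theta> (Suc n)) *s v (Suc n) = k *s v n" by auto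
    then show ?thesis by (auto simp: algebra_simps)
  qed
  then obtain a where "\<forall>n<d. A (v (Suc n)) = (1 / \<theta> (Suc n)) *s v (Suc n) + a n *s v n" by metis
  moreover have "A (v 0) = (1 / \<theta> 0) *s v 0"
  proof -
    have "\<theta> 0 * q\<^sup>2 \<noteq> \<theta> n" if "n \<le> d" for n
    proof
      assume "\<theta> 0 * q\<^sup>2 = \<theta> n"
      then have "q ^ (2 + 2 * n) = q ^ 0"
        using q_nonzero by (simp add: \<theta>_def field_simps power_add power2_eq_square)
      then show False unfolding q_pow_inj by simp
    qed
    from eigenvector_D(2)[OF weyl_pair_lowers[OF assms], of 0, OF _ this] show ?thesis by simp
  qed
  ultimately show ?thesis unfolding lowers_def by blast
qed

lemma q_sq_minus_1: "q\<^sup>2 - 1 \<noteq> 0"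
  using q_not_root[of 2] by simp

text \<open>This is \<open>- (q - q\<^sup>-\<^sup>1)\<^sup>2 q\<^bsup>2n+1-d\<^esup> [n+1]\<^sub>q [d-n]\<^sub>q\<close>, the product of raising and lowering
  coefficients known from the \<open>(d+1)\<close>-dimensional irreducible module of the quantum group of
  \<open>sl\<^sub>2\<close>.\<close>

definition \<phi> :: "nat \<Rightarrow> 'f"
  where "\<phi> n = (q ^ (2 * n + 2) - 1) * (q ^ (2 * n) / q ^ (2 * d) - 1)"

lemma \<phi>_nonzero: assumes "n < d" shows "\<phi> n \<noteq> 0"
proof -
  have "q ^ (2 * n + 2) \<noteq> q ^ 0" "q ^ (2 * n) \<noteq> q ^ (2 * d)"
    using assms unfolding q_pow_inj by auto
  then show ?thesis using q_nonzero by (auto simp: \<phi>_def)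
qed

lemma q_power_even: "q ^ (2 * n) = q ^ n * q ^ n" "q ^ (n * 2) = q ^ n * q ^ n"
  by (simp_all add: mult_2 mult_2_right power_add)

text \<open>The recursion for \<open>\<phi>\<close> is the diagonal part of the q-Weyl relation between a raising
  and a lowering operator; \<open>\<phi>_0\<close> is its start, where \<open>v 0\<close> has no predecessor.\<close>

lemma \<phi>_0:
  "q * (1 / \<theta> 0 * (1 / \<theta> 0)) - inverse q * (1 / \<theta> 0 * (1 / \<theta> 0) + \<phi> 0) = q - inverse q"
  using q_nonzero by (simp add: \<phi>_def \<theta>_def q_power_even field_simps power2_eq_square)

lemma \<phi>_Suc:
  "q * (1 / \<theta> (Suc n) * (1 / \<theta> (Suc n)) + \<phi> n)
    - inverse q * (1 / \<theta> (Suc n) * (1 / \<theta> (Suc n)) + \<phi> (Suc n)) = q - inverse q"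
proof -
  define p s where "p = q ^ d" and "s = q ^ n"
  have nz: "p \<noteq> 0" "s \<noteq> 0" using q_nonzero by (auto simp: p_def s_def)
  have *: "\<theta> (Suc n) = p / (s * s * q * q)" "\<phi> n = (s * s * q * q - 1) * (s * s / (p * p) - 1)"
    "\<phi> (Suc n) = (s * s * q * q * q * q - 1) * (s * s * q * q / (p * p) - 1)"
    by (simp_all add: \<theta>_def \<phi>_def p_def s_def power_add q_power_even mult_ac power2_eq_square)
  show ?thesis unfolding * using q_nonzero nz by (simp add: field_simps)
qed

text \<open>The relation between \<open>A\<close> and \<open>C\<close>, compared at the coefficient of \<open>v n\<close> in the image
  of \<open>v n\<close>, determines \<open>a n * c n\<close> from \<open>a (n-1) * c (n-1)\<close>. The products are thus
  independent of the module and of the scaling of the basis.\<close>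

lemma raise_lower_product:
  assumes "endo A" "endo C" "weyl_pair q A C" "raises A a" "lowers C c" "n < d"
  shows "a n * c n = \<phi> n"
  using assms(6)
proof (induction n)
  case 0
  interpret A: Vector_Spaces.linear scale scale A by fact
  interpret C: Vector_Spaces.linear scale scale C by fact
  define t where "t n = 1 / \<theta> n" for n
  have A: "A (v 0) = t 0 *s v 0 + a 0 *s v (Suc 0)" and C: "C (v 0) = t 0 *s v 0"
    "C (v (Suc 0)) = t (Suc 0) *s v (Suc 0) + c 0 *s v 0"
    using assms(4,5) 0 by (auto simp: raises_def lowers_def t_def)
  have "q *s A (C (v 0)) - inverse q *s C (A (v 0)) = (q - inverse q) *s v 0"
    using assms(3) by (simp add: weyl_pair_def)
  then have "(q * (t 0 * t 0) - inverse q * (t 0 * t 0 + a 0 * c 0)) *s v 0 +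
      (q * t 0 * a 0 - inverse q * a 0 * t (Suc 0)) *s v (Suc 0)
     = (q - inverse q) *s v 0 + 0 *s v (Suc 0)"
    by (simp add: A C A.add A.scale C.add C.scale algebra_simps)
  from two_coeffs_unique(1)[OF this] 0
  have "inverse q * (t 0 * t 0 + a 0 * c 0) = inverse q * (t 0 * t 0 + \<phi> 0)"
    using \<phi>_0 unfolding t_def by (simp add: algebra_simps)
  then show ?case using q_nonzero by simp
next
  case (Suc n)
  interpret A: Vector_Spaces.linear scale scale A by fact
  interpret C: Vector_Spaces.linear scale scale C by fact
  define t where "t n = 1 / \<theta> n" for n
  have A: "A (v (Suc n)) = t (Suc n) *s v (Suc n) + a (Suc n) *s v (Suc (Suc n))"
    "A (v n) = t n *s v n + a n *s v (Suc n)"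
    and C: "C (v (Suc n)) = t (Suc n) *s v (Suc n) + c n *s v n"
    "C (v (Suc (Suc n))) = t (Suc (Suc n)) *s v (Suc (Suc n)) + c (Suc n) *s v (Suc n)"
    using assms(4,5) Suc.prems by (auto simp: raises_def lowers_def t_def)
  have "q *s A (C (v (Suc n))) - inverse q *s C (A (v (Suc n))) = (q - inverse q) *s v (Suc n)"
    using assms(3) by (simp add: weyl_pair_def)
  then have "
      (q * t (Suc n) * a (Suc n) - inverse q * a (Suc n) * t (Suc (Suc n))) *s v (Suc (Suc n))
     + (q * (t (Suc n) * t (Suc n) + a n * c n)
        - inverse q * (t (Suc n) * t (Suc n) + a (Suc n) * c (Suc n))
        - (q - inverse q)) *s v (Suc n)
     + (q * c n * t n - inverse q * t (Suc n) * c n) *s v n = 0"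
    by (simp add: A C A.add A.scale C.add C.scale algebra_simps)
  from three_coeffs_zero(2)[OF this] Suc
  have "q * (t (Suc n) * t (Suc n) + \<phi> n)
      - inverse q * (t (Suc n) * t (Suc n) + a (Suc n) * c (Suc n)) = q - inverse q"
    by simp
  then have "inverse q * (t (Suc n) * t (Suc n) + a (Suc n) * c (Suc n))
      = inverse q * (t (Suc n) * t (Suc n) + \<phi> (Suc n))"
    using \<phi>_Suc[of n] unfolding t_def by (simp add: algebra_simps)
  then show ?case using q_nonzero by simp
qed

text \<open>For a q-Weyl pair \<open>(S, A)\<close> with \<open>S\<close> inverse to \<open>B\<close>, multiplying the relation by \<open>B\<close>
  on both sides gives the hypothesis \<open>AB\<close>. Its coefficient at \<open>v (n+2)\<close> in the image of \<open>v n\<close>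
  says that \<open>1 - a n / b n\<close> is divided by \<open>q\<^sup>2\<close> when \<open>n\<close> grows by 1, just like \<open>\<theta> n\<close>. The
  common ratio of the two is \<open>\<tau>\<close>.\<close>

lemma raises_ratio:
  assumes "endo A" "endo B" "raises A a" "raises B b" "\<And>n. n < d \<Longrightarrow> b n \<noteq> 0"
    and AB: "\<And>u. q *s A (B u) - inverse q *s B (A u) = (q - inverse q) *s B (B u)"
  shows "\<exists>\<tau>. \<forall>n<d. a n = b n * (1 - \<tau> * \<theta> n)"
proof -
  interpret A: Vector_Spaces.linear scale scale A by fact
  interpret B: Vector_Spaces.linear scale scale B by fact
  define r where "r n = (1 - a n / b n) / \<theta> n" for n
  have r_Suc: "r (Suc n) = r n" if "Suc n < d" for n
  proof -
    define t where "t n = 1 / \<theta> n" for n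
    let ?m = "Suc n" let ?k = "Suc (Suc n)"
    have A: "A (v n) = t n *s v n + a n *s v ?m" "A (v ?m) = t ?m *s v ?m + a ?m *s v ?k"
      and B: "B (v n) = t n *s v n + b n *s v ?m" "B (v ?m) = t ?m *s v ?m + b ?m *s v ?k"
      using assms(3,4) that by (auto simp: raises_def t_def)
    have t: "t n \<noteq> 0" "t ?m = q\<^sup>2 * t n" by (simp_all add: t_def \<theta>_Suc)
    have "q *s A (B (v n)) - inverse q *s B (A (v n)) - (q - inverse q) *s B (B (v n)) = 0"
      using AB by simp
    then have "(q * b n * a ?m - inverse q * a n * b ?m - (q - inverse q) * b n * b ?m) *s v ?k
      + (q * (t n * a n + b n * t ?m) - inverse q * (t n * b n + a n * t ?m)
          - (q - inverse q) * (t n * b n + b n * t ?m)) *s v ?m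
      + (q * (t n * t n) - inverse q * (t n * t n) - (q - inverse q) * (t n * t n)) *s v n = 0"
      by (simp add: A B A.add A.scale B.add B.scale algebra_simps)
    from three_coeffs_zero(1)[OF this] that
    have "q * b n * a ?m - inverse q * a n * b ?m = (q - inverse q) * b n * b ?m" by simp
    moreover have "q * (q * b n * a ?m - inverse q * a n * b ?m) = q\<^sup>2 * b n * a ?m - a n * b ?m"
      "q * ((q - inverse q) * b n * b ?m) = (q\<^sup>2 - 1) * b n * b ?m"
      using q_nonzero by (simp_all add: right_diff_distrib left_diff_distrib power2_eq_square)
    ultimately have *: "q\<^sup>2 * b n * a ?m - a n * b ?m = (q\<^sup>2 - 1) * b n * b ?m"
      by metis
    have "b n \<noteq> 0" "b ?m \<noteq> 0" using assms(5) that by auto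
    then have "(1 - a ?m / b ?m) * q\<^sup>2 = 1 - a n / b n"
      using * by (simp add: divide_simps) (simp add: algebra_simps)
    then show ?thesis by (simp add: r_def \<theta>_Suc)
  qed
  have "r n = r 0" if "n < d" for n
    using that by (induction n) (auto simp: r_Suc)
  then have "a n = b n * (1 - r 0 * \<theta> n)" if "n < d" for n
    using assms(5)[OF that] that by (auto simp: r_def field_simps)
  then show ?thesis by blast
qed

text \<open>The coordinate form \<open>a n = b n * (1 - \<tau> * \<theta> n)\<close> becomes an identity of operators because
  \<open>\<theta> n\<close> is the eigenvalue of \<open>D\<close>. In this form it no longer refers to a basis and can be
  transported from one index \<open>i\<close> to another.\<close>

lemma raises_affine:
  assumes "endo A" "endo B" "raises A a" "raises B b" "\<forall>n<d. a n = b n * (1 - \<tau> * \<theta> n)"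
  shows "A u = B u + \<tau> *s (u - B (D u))"
proof -
  interpret D: Vector_Spaces.linear scale scale D by (rule linear_D)
  interpret B: Vector_Spaces.linear scale scale B by fact
  show ?thesis
  proof (rule endo_eqI[OF assms(1)])
    show "endo (\<lambda>u. B u + \<tau> *s (u - B (D u)))"
      by unfold_locales (simp_all add: B.add D.add B.scale D.scale algebra_simps)
    fix n assume n: "n \<le> d"
    show "A (v n) = B (v n) + \<tau> *s (v n - B (D (v n)))"
    proof (cases "n < d")
      case True
      then show ?thesis using assms(3,4,5)
        by (simp add: raises_def D_\<theta> B.scale algebra_simps)
    next
      case False
      then show ?thesis using assms(3,4,5) n
        by (simp add: raises_def D_\<theta> B.scale)
    qed
  qed
qed

lemma affine_raises:
  assumes "endo B" "raises B b" "\<And>u. A u = B u + \<tau> *s (u - B (D u))"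
  shows "raises A (\<lambda>n. b n * (1 - \<tau> * \<theta> n))"
proof -
  interpret B: Vector_Spaces.linear scale scale B by fact
  show ?thesis using assms(2)
    by (simp add: raises_def D_\<theta> B.scale assms(3) algebra_simps)
qed

lemma weight_basis_rescale:
  assumes "\<And>n. n \<le> d \<Longrightarrow> k n \<noteq> 0"
  shows "weight_basis scale q d D (\<lambda>n. k n *s v n)"
proof unfold_locales
  interpret D: Vector_Spaces.linear scale scale D by (rule linear_D)
  show "q \<noteq> 0" by (rule q_nonzero)
  show "q ^ n \<noteq> 1" if "0 < n" for n by (rule q_not_root[OF that])
  show "D (k n *s v n) = (q ^ d / q ^ (2 * n)) *s k n *s v n" if "n \<le> d" for n
    using that by (simp add: D.scale D_v mult.commute)
  show "k n *s v n \<noteq> 0" if "n \<le> d" for n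
    using that assms v_nonzero by simp
  have "v n \<in> span ((\<lambda>n. k n *s v n) ` {..d})" if "n \<le> d" for n
  proof -
    have "inverse (k n) *s k n *s v n \<in> span ((\<lambda>n. k n *s v n) ` {..d})"
      using that by (intro span_scale span_base) auto
    then show ?thesis using assms[OF that] by simp
  qed
  then have "span (v ` {..d}) \<subseteq> span ((\<lambda>n. k n *s v n) ` {..d})"
    by (intro span_minimal) auto
  then show "span ((\<lambda>n. k n *s v n) ` {..d}) = UNIV" using span_v by auto
qed (use linear_D in \<open>auto simp: Vector_Spaces.linear_iff\<close>)

lemma raises_rescale:
  assumes "endo A" "raises A a" "\<And>n. k (Suc n) = a n * k n" "\<And>n. n \<le> d \<Longrightarrow> k n \<noteq> 0"
  shows "weight_basis.raises scale q d (\<lambda>n. k n *s v n) A (\<lambda>_. 1)"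
proof -
  interpret A: Vector_Spaces.linear scale scale A by fact
  interpret k: weight_basis scale q d D "\<lambda>n. k n *s v n"
    by (rule weight_basis_rescale) (rule assms(4))
  show ?thesis using assms(2)
    by (simp add: raises_def k.raises_def A.scale scale_right_distrib assms(3) mult_ac)
qed

text \<open>Applied to \<open>v d\<close>, the relation \<open>BF\<close> involves only \<open>v d\<close> and \<open>v (d-1)\<close>, since \<open>v d\<close>
  is an eigenvector of \<open>A\<close> and \<open>B\<close>. With \<open>p = q\<^sup>d\<close>, the coefficient of \<open>v d\<close> simplifies to
  \<open>(p\<^sup>2 - 1) * (\<tau> * \<sigma> * q\<^sup>2 - 1) = 0\<close>, once the product of the coefficients of \<open>B\<close>
  and \<open>C\<close> between \<open>v (d-1)\<close> and \<open>v d\<close> is eliminated by means of \<open>raise_lower_product\<close>. The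
  condition \<open>0 < d\<close> makes the first factor nonzero.\<close>

lemma parameter_product:
  assumes "0 < d" "endo A" "endo B" "endo C" "weyl_pair q D B" "weyl_pair q A C" "raises B b"
    and "lowers C c" "\<And>n. n < d \<Longrightarrow> b n \<noteq> 0"
    and A: "\<And>u. A u = B u + \<tau> *s (u - B (D u))"
    and F: "\<And>u. F u = C u + \<sigma> *s (u - C (A u))"
    and BF: "\<And>u. q *s B (F u) - inverse q *s F (B u) = (q - inverse q) *s B (B u)"
  shows "\<tau> * \<sigma> * q\<^sup>2 = 1"
proof -
  interpret A: Vector_Spaces.linear scale scale A by fact
  interpret B: Vector_Spaces.linear scale scale B by fact
  interpret C: Vector_Spaces.linear scale scale C by fact
  obtain n where n: "Suc n = d" using assms(1) by (cases d) auto
  define p where "p = q ^ d"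
  have p: "p \<noteq> 0" "\<theta> d = 1 / p" "\<theta> n = q\<^sup>2 / p"
    unfolding p_def \<theta>_def q_power_even using q_nonzero
    by (simp_all add: n[symmetric] power2_eq_square)
  have aR: "raises A (\<lambda>n. b n * (1 - \<tau> * \<theta> n))" by (rule affine_raises) fact+
  have bc: "b n * (1 - \<tau> * \<theta> n) * c n = \<phi> n"
    using raise_lower_product[OF assms(2,4,6) aR assms(8), of n] n by auto
  have Av: "A (v d) = p *s v d" and Bv: "B (v d) = p *s v d"
    and Cv: "C (v d) = p *s v d + c n *s v n"
    and Bn: "B (v n) = (p / q\<^sup>2) *s v n + b n *s v d"
    using aR assms(7,8) p n by (auto simp: raises_def lowers_def dest: spec[of _ n])
  define m where "m = 1 - \<sigma> * p"
  have Fv: "F (v d) = (m * p + \<sigma>) *s v d + (m * c n) *s v n"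
    by (simp add: F Av Cv C.scale m_def algebra_simps)
  have Fv': "F (p *s v d) = p *s F (v d)"
    by (simp add: F A.scale C.scale algebra_simps)
  have "q *s B (F (v d)) - inverse q *s F (B (v d)) = (q - inverse q) *s B (B (v d))" by (rule BF)
  then have "(q * ((m * p + \<sigma>) * p + m * c n * b n) - inverse q * p * (m * p + \<sigma>)) *s v d
     + (q * m * c n * (p / q\<^sup>2) - inverse q * p * m * c n) *s v n
       = ((q - inverse q) * p * p) *s v d + 0 *s v n"
    by (simp add: Bv Fv' Fv B.add B.scale Bn algebra_simps)
  from two_coeffs_unique(1)[OF this] n[symmetric]
  have "q * ((m * p + \<sigma>) * p + m * c n * b n) - inverse q * p * (m * p + \<sigma>)
      = (q - inverse q) * p * p"
    by simp
  then have "q * (q * ((m * p + \<sigma>) * p + m * c n * b n) - inverse q * p * (m * p + \<sigma>))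
      = q * ((q - inverse q) * p * p)"
    by simp
  then have 1: "(q\<^sup>2 - 1) * p * (m * p + \<sigma>) + q\<^sup>2 * m * (c n * b n) = (q\<^sup>2 - 1) * p * p"
    using q_nonzero by (simp add: right_diff_distrib left_diff_distrib power2_eq_square mult_ac
        distrib_left distrib_right)
      (simp add: algebra_simps)
  have \<phi>: "q\<^sup>2 * \<phi> n = (p\<^sup>2 - 1) * (1 - q\<^sup>2)"
  proof -
    have "\<phi> n = (p\<^sup>2 - 1) * (1 / q\<^sup>2 - 1)" unfolding \<phi>_def p_def using q_nonzero
      by (simp add: n[symmetric] q_power_even power2_eq_square mult_ac)
    then show ?thesis using q_nonzero by (simp add: field_simps power2_eq_square)
  qed
  define w where "w = 1 - \<tau> * \<theta> n"
  have w: "p * w = p - \<tau> * q\<^sup>2" using p by (simp add: w_def field_simps)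
  have "w * ((q\<^sup>2 - 1) * p * (m * p + \<sigma>)) + m * ((p\<^sup>2 - 1) * (1 - q\<^sup>2)) = w * ((q\<^sup>2 - 1) * p * p)"
  proof -
    have "w * (q\<^sup>2 * m * (c n * b n)) = m * (q\<^sup>2 * (b n * w * c n))" by (simp add: mult_ac)
    also have "\<dots> = m * ((p\<^sup>2 - 1) * (1 - q\<^sup>2))" using bc \<phi> by (simp add: w_def)
    finally have *: "w * (q\<^sup>2 * m * (c n * b n)) = m * ((p\<^sup>2 - 1) * (1 - q\<^sup>2))" .
    show ?thesis using arg_cong[OF 1, of "\<lambda>x. w * x"] by (simp only: distrib_left[of w] *)
  qed
  then have "(q\<^sup>2 - 1) * (w * p * (m * p + \<sigma>) - m * (p\<^sup>2 - 1) - w * p * p) = 0"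
    by (simp add: algebra_simps)
  then have "(p * w) * (m * p + \<sigma>) - m * (p\<^sup>2 - 1) - (p * w) * p = 0"
    using q_sq_minus_1 by (simp add: mult_ac)
  then have "(p\<^sup>2 - 1) * (\<tau> * \<sigma> * q\<^sup>2 - 1) = 0"
    unfolding w m_def by (simp add: algebra_simps power2_eq_square)
  moreover have "p\<^sup>2 - 1 \<noteq> 0"
    using q_not_root[of "d * 2"] assms(1) by (simp add: p_def flip: power_mult)
  ultimately show ?thesis by simp
qed

lemma inj_on_v: "inj_on v {..d}"
proof (rule inj_onI)
  fix m n assume mn: "m \<in> {..d}" "n \<in> {..d}" "v m = v n"
  then have "\<theta> m *s v m = \<theta> n *s v m" using D_\<theta>[of m] D_\<theta>[of n] by auto
  then have "\<theta> m = \<theta> n" using v_nonzero[of n] mn by auto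
  then show "m = n" by (simp add: \<theta>_inj)
qed

lemma independent_v: "independent (v ` {..d})"
proof (rule independent_if_scalars_zero)
  fix f x assume *: "(\<Sum>x\<in>v ` {..d}. f x *s x) = 0" "x \<in> v ` {..d}"
  then have "(\<Sum>n\<le>d. f (v n) *s v n) = 0" by (simp add: sum.reindex[OF inj_on_v])
  then show "f x = 0" using coeffs_zero *(2) by auto
qed simp

lemma basis_map:
  assumes "weight_basis scale q d D' w"
  obtains Y where "endo Y" "bij Y" "\<And>n. n \<le> d \<Longrightarrow> Y (v n) = w n"
proof -
  interpret w: weight_basis scale q d D' w by fact
  interpret vector_space_pair scale scale ..
  obtain Y where Y: "endo Y" "\<forall>x\<in>v ` {..d}. Y x = (w \<circ> inv_into {..d} v) x"
    using linear_independent_extend[OF independent_v] by blast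
  interpret Y: Vector_Spaces.linear scale scale Y by fact
  have Yv: "Y (v n) = w n" if "n \<le> d" for n
    using Y(2) that by (simp add: inv_into_f_f[OF inj_on_v])
  have "inj Y"
    unfolding Y.inj_iff_eq_0
  proof (intro allI impI)
    fix u assume "Y u = 0"
    moreover obtain k where k: "u = (\<Sum>n\<le>d. k n *s v n)" using span_coeffs by blast
    ultimately have "(\<Sum>n\<le>d. k n *s w n) = 0" by (simp add: Y.sum Y.scale Yv)
    then have "k n = 0" if "n \<le> d" for n using w.coeffs_zero that by blast
    then show "u = 0" by (simp add: k)
  qed
  moreover have "surj Y"
  proof -
    have "u \<in> range Y" for u
    proof -
      obtain k where "u = (\<Sum>n\<le>d. k n *s w n)" using w.span_coeffs by blast
      then have "u = Y (\<Sum>n\<le>d. k n *s v n)" by (simp add: Y.sum Y.scale Yv)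
      then show ?thesis by blast
    qed
    then show ?thesis by blast
  qed
  ultimately show ?thesis using that Y(1) Yv by (auto simp: bij_def)
qed

lemma intertwineI:
  assumes "endo Y" "endo S" "endo S'" "\<And>n. n \<le> d \<Longrightarrow> Y (S (v n)) = S' (Y (v n))"
  shows "Y (S u) = S' (Y u)"
  using endo_eqI[OF Vector_Spaces.linear_compose[OF assms(2,1)]
    Vector_Spaces.linear_compose[OF assms(1,3)], of u]
    assms(4) by simp

text \<open>Once \<open>B\<close> has all coefficients 1, those of \<open>A\<close> are \<open>1 - \<tau> * \<theta> n\<close>, which are nonzero
  as factors of \<open>\<phi> n\<close>; so \<open>C\<close> is determined by \<open>\<tau>\<close>.\<close>

lemma lowers_normalised:
  assumes "endo A" "endo B" "endo C" "weyl_pair q A C" "raises B (\<lambda>_. 1)" "lowers C c"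
    and A: "\<And>u. A u = B u + \<tau> *s (u - B (D u))"
  shows "lowers C (\<lambda>n. \<phi> n / (1 - \<tau> * \<theta> n))"
proof -
  have aR: "raises A (\<lambda>n. 1 * (1 - \<tau> * \<theta> n))" by (rule affine_raises) fact+
  have "c n = \<phi> n / (1 - \<tau> * \<theta> n)" if "n < d" for n
  proof -
    have "(1 - \<tau> * \<theta> n) * c n = \<phi> n"
      using raise_lower_product[OF assms(1,3,4) aR assms(6) that] by simp
    moreover from this have "1 - \<tau> * \<theta> n \<noteq> 0" using \<phi>_nonzero[OF that] by auto
    ultimately show ?thesis by (simp add: eq_divide_eq mult.commute)
  qed
  then show ?thesis using assms(6) by (simp add: lowers_def)
qed

lemma intertwine_raises:
  assumes "weight_basis scale q d D' w" "endo Y" "\<And>n. n \<le> d \<Longrightarrow> Y (v n) = w n"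
    "endo B" "endo B'" "raises B b" "weight_basis.raises scale q d w B' b"
  shows "Y (B u) = B' (Y u)"
proof (rule intertwineI[of Y B B'])
  interpret w: weight_basis scale q d D' w by fact
  interpret Y: Vector_Spaces.linear scale scale Y by fact
  show "Y (B (v n)) = B' (Y (v n))" if "n \<le> d" for n
    using that assms(6,7)
    by (cases "n = d") (auto simp: raises_def w.raises_def Y.add Y.scale assms(3))
qed fact+

lemma intertwine_lowers:
  assumes "weight_basis scale q d D' w" "endo Y" "\<And>n. n \<le> d \<Longrightarrow> Y (v n) = w n"
    "endo B" "endo B'" "lowers B b" "weight_basis.lowers scale q d w B' b"
  shows "Y (B u) = B' (Y u)"
proof (rule intertwineI[of Y B B'])
  interpret w: weight_basis scale q d D' w by fact
  interpret Y: Vector_Spaces.linear scale scale Y by fact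
  show "Y (B (v n)) = B' (Y (v n))" if "n \<le> d" for n
    using that assms(6,7) by (cases n) (auto simp: lowers_def w.lowers_def Y.add Y.scale assms(3))
qed fact+

text \<open>An eigenvector of a bidiagonal operator can be solved for recursively. For the eigenvalue
  \<open>q\<^sup>d\<close> no coordinate vanishes, because the \<open>c n\<close> are nonzero and \<open>q\<^sup>d\<close> occurs on the diagonal
  only in the last place. In \<open>ijkl_basis_exists\<close> its components form the basis.\<close>

lemma lowers_eigenvector:
  assumes "endo C" "lowers C c" "\<And>n. n < d \<Longrightarrow> c n \<noteq> 0"
  obtains y where "\<And>n. n \<le> d \<Longrightarrow> y n \<noteq> 0"
    "C (\<Sum>n\<le>d. y n *s v n) = q ^ d *s (\<Sum>n\<le>d. y n *s v n)"
proof -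
  interpret C: Vector_Spaces.linear scale scale C by fact
  \<comment> \<open>Comparing the coefficients of \<open>v n\<close> in \<open>C u = q\<^sup>d *s u\<close> gives this recursion.\<close>
  define y where "y = rec_nat 1 (\<lambda>n yn. (q ^ d - 1 / \<theta> n) / c n * yn)"
  have y: "y 0 = 1" "y (Suc n) = (q ^ d - 1 / \<theta> n) / c n * y n" for n by (simp_all add: y_def)
  have gap: "q ^ d - 1 / \<theta> n \<noteq> 0" if "n < d" for n
  proof
    assume "q ^ d - 1 / \<theta> n = 0"
    then have "q ^ (d + d) = q ^ (2 * n)"
      using q_nonzero by (simp add: \<theta>_def field_simps power_add)
    then show False using that by (simp add: q_pow_inj)
  qed
  have "y n \<noteq> 0" if "n \<le> d" for n
    using that by (induction n) (use gap assms(3) in \<open>auto simp: y\<close>)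
  \<comment> \<open>The defect of the truncated sum vanishes for \<open>m = d\<close>, where \<open>1 / \<theta> d = q\<^sup>d\<close>.\<close>
  moreover have "C (\<Sum>n\<le>m. y n *s v n) = q ^ d *s (\<Sum>n\<le>m. y n *s v n) -
      ((q ^ d - 1 / \<theta> m) * y m) *s v m"
    if "m \<le> d" for m
    using that
  proof (induction m)
    case 0
    then show ?case using assms(2) by (simp add: C.scale lowers_def algebra_simps y)
  next
    case (Suc m)
    have "c m * y (Suc m) = (q ^ d - 1 / \<theta> m) * y m" using assms(3) Suc.prems by (simp add: y(2))
    then have "C (y (Suc m) *s v (Suc m)) = (y (Suc m) * (1 / \<theta> (Suc m))) *s v (Suc m) +
        ((q ^ d - 1 / \<theta> m) * y m) *s v m"
      using assms(2) Suc.prems by (simp add: C.scale lowers_def scale_right_distrib mult_ac)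
    then have "C (\<Sum>n\<le>Suc m. y n *s v n) = q ^ d *s (\<Sum>n\<le>m. y n *s v n) +
        (y (Suc m) * (1 / \<theta> (Suc m))) *s v (Suc m)"
      using Suc by (simp add: C.add)
    then show ?case by (simp add: algebra_simps)
  qed
  from this[of d] have "C (\<Sum>n\<le>d. y n *s v n) = q ^ d *s (\<Sum>n\<le>d. y n *s v n)"
    using q_nonzero by (simp add: \<theta>_def q_power_even)
  ultimately show ?thesis by (rule that)
qed

end

section \<open>The parameters of an evaluation module\<close>

locale generic_evaluation_module = evaluation_module +
  assumes q_nonzero: "q \<noteq> 0" and q_not_root: "\<And>n. n > 0 \<Longrightarrow> q ^ n \<noteq> 1"
begin

abbreviation x :: "4 \<Rightarrow> 4 \<Rightarrow> 'b \<Rightarrow> 'b" where "x \<equiv> gen_act"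

lemma q_powi_diameter: "q powi (int diameter - 2 * int n) = q ^ diameter / q ^ (2 * n)"
proof -
  have *: "int diameter - 2 * int n = int diameter - int (2 * n)" by simp
  have "q powi (int diameter - int (2 * n)) = q powi int diameter / q powi int (2 * n)"
    by (rule power_int_diff) (use q_nonzero in simp)
  then show ?thesis unfolding * by (simp only: power_int_of_nat)
qed

lemma decomp_dim: "i \<noteq> j \<Longrightarrow> n \<le> diameter \<Longrightarrow> dim (decomp i j n) = 1"
  using arg_cong[OF shape_ones, of i j "\<lambda>xs. xs ! n"]
  by (simp add: shape_def nth_append less_Suc_eq_le del: upt_Suc replicate_Suc)

text \<open>The shape makes every eigenspace a line, and diagonalizability together with the list of
  eigenvalues makes these lines span the module.\<close>

lemma weight_basis_exists:
  assumes "std_index i j"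
  shows "\<exists>v. weight_basis scale q diameter (x i j) v"
proof -
  interpret D: Vector_Spaces.linear scale scale "x i j" by (rule gen_act_linear)
  have ij: "i \<noteq> j" using assms by (auto simp: std_index_def)
  have "\<exists>b. b \<noteq> 0 \<and> x i j b = (q ^ diameter / q ^ (2 * n)) *s b \<and> decomp i j n \<subseteq> span {b}"
    if n: "n \<le> diameter" for n
  proof -
    obtain B where B: "B \<subseteq> decomp i j n" "independent B" "decomp i j n \<subseteq> span B" "card B = 1"
      using basis_exists[of "decomp i j n"] decomp_dim[OF ij n] by metis
    then obtain b where "B = {b}" by (auto simp: card_1_singleton_iff)
    then show ?thesis using B assms
      by (intro exI[of _ b]) (auto simp: decomp_def eigenspace_def q_powi_diameter)
  qed
  then obtain v where v: "\<And>n. n \<le> diameter \<Longrightarrow> v n \<noteq> 0"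
    "\<And>n. n \<le> diameter \<Longrightarrow> x i j (v n) = (q ^ diameter / q ^ (2 * n)) *s v n"
    "\<And>n. n \<le> diameter \<Longrightarrow> decomp i j n \<subseteq> span {v n}"
    by metis
  obtain B where B: "independent B" "span B = UNIV"
    "\<And>b. b \<in> B \<Longrightarrow> \<exists>c. x i j b = c *s b"
    using type_1 assms unfolding has_diameter_type_def diagonalizable_def by blast
  have "b \<in> span (v ` {..diameter})" if "b \<in> B" for b
  proof -
    obtain c where c: "x i j b = c *s b" using B(3) \<open>b \<in> B\<close> by blast
    have "b \<noteq> 0" using B(1) that dependent_zero by blast
    then have "c \<in> eigenvalues (x i j)" using c by (auto simp: eigenvalues_def)
    then obtain n where n: "n \<le> diameter" "c = q powi (int diameter - 2 * int n)"
      using type_1 assms unfolding has_diameter_type_def by auto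
    then have "b \<in> decomp i j n" using c assms by (simp add: decomp_def eigenspace_def)
    then have "b \<in> span {v n}" using v(3) n(1) by blast
    moreover have "span {v n} \<subseteq> span (v ` {..diameter})" using n(1) by (intro span_mono) auto
    ultimately show ?thesis by blast
  qed
  then have "span B \<subseteq> span (v ` {..diameter})" by (intro span_minimal) auto
  then have "weight_basis scale q diameter (x i j) v"
    by unfold_locales
      (use v B(2) q_nonzero q_not_root in \<open>auto simp: D.add D.scale\<close>)
  then show ?thesis by blast
qed

text \<open>In diameter 0 every standard generator has 1 as its only eigenvalue on a line, so the
  module would be trivial.\<close>

lemma diameter_pos: "diameter > 0"
proof (rule ccontr)
  assume "\<not> diameter > 0"
  then have d: "diameter = 0" by simp
  have "x i j = id" if "std_index i j" for i j
  proof
    fix u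
    obtain v where "weight_basis scale q diameter (x i j) v"
      using weight_basis_exists[OF \<open>std_index i j\<close>] by blast
    then interpret v: weight_basis scale q diameter "x i j" v .
    show "x i j u = id u"
      by (rule v.endo_eqI[OF gen_act_linear linear_id]) (use d v.D_v in simp)
  qed
  moreover have "dim UNIV = 1"
  proof -
    obtain v where "weight_basis scale q diameter (x 0 1) v"
      using weight_basis_exists[of 0 1] by (auto simp: std_index_def)
    then interpret v: weight_basis scale q diameter "x 0 1" v .
    have "dim (span (v ` {..diameter})) = 1"
      using dim_span_eq_card_independent[OF v.independent_v] d by simp
    then show ?thesis by (simp only: v.span_v)
  qed
  ultimately show False using nontrivial by (simp add: trivial_module_def)
qed

lemma weyl:
  assumes "(j - i, k - j) \<in> {(1, 1), (1, 2), (2, 1)}"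
  shows "weyl_pair q (x i j) (x j k)"
proof -
  have "q - inverse q \<noteq> 0"
    using q_nonzero q_not_root[of 2] by (auto simp: power2_eq_square field_simps)
  then show ?thesis unfolding weyl_pair_def using gen_act_weyl[OF assms] by blast
qed

lemma weyl_cycle:
  "weyl_pair q (x i (i+1)) (x (i+1) (i+2))" "weyl_pair q (x (i+1) (i+2)) (x (i+2) i)"
  "weyl_pair q (x (i+2) i) (x i (i+1))"
  "weyl_pair q (x i (i+1)) (x (i+1) (i+3))" "weyl_pair q (x (i+1) (i+3)) (x (i+3) i)"
  "weyl_pair q (x (i+3) i) (x i (i+1))"
  by (rule weyl, use mod4_cases[of i] in auto)+

lemma diagonal_inverse:
  "x i (i+2) (x (i+2) i u) = u"  "x (i+2) i (x i (i+2) u) = u"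
  "x (i+1) (i+3) (x (i+3) (i+1) u) = u"  "x (i+3) (i+1) (x (i+1) (i+3) u) = u"
  by (rule gen_act_inverse, use mod4_cases[of i] in auto)+

text \<open>The q-Weyl relations of \<open>A\<close> and of \<open>F\<close> with the inverse of \<open>B\<close>, multiplied by \<open>B\<close> on
  both sides.\<close>

lemma twisted_relation:
  fixes i :: 4
  defines "A \<equiv> x (i+1) (i+2)" and "B \<equiv> x (i+1) (i+3)" and "F \<equiv> x (i+2) (i+3)"
  shows "q *s A (B u) - inverse q *s B (A u) = (q - inverse q) *s B (B u)"
    and "q *s B (F u) - inverse q *s F (B u) = (q - inverse q) *s B (B u)"
proof -
  interpret B: Vector_Spaces.linear scale scale B unfolding B_def by (rule gen_act_linear)
  have inv: "B (x (i+3) (i+1) w) = w" "x (i+3) (i+1) (B w) = w" for w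
    unfolding B_def by (rule diagonal_inverse)+
  have "weyl_pair q (x (i+3) (i+1)) A" "weyl_pair q F (x (i+3) (i+1))"
    unfolding A_def F_def by (rule weyl, use mod4_cases[of i] in auto)+
  then have "q *s x (i+3) (i+1) (A (B u)) - inverse q *s A (x (i+3) (i+1) (B u))
      = (q - inverse q) *s B u"
    "q *s F (x (i+3) (i+1) (B u)) - inverse q *s x (i+3) (i+1) (F (B u)) = (q - inverse q) *s B u"
    unfolding weyl_pair_def by blast+
  from this[THEN arg_cong[of _ _ B]]
  show "q *s A (B u) - inverse q *s B (A u) = (q - inverse q) *s B (B u)"
    and "q *s B (F u) - inverse q *s F (B u) = (q - inverse q) *s B (B u)"
    by (simp_all add: B.diff B.scale inv)
qed

text \<open>The identity \<open>A = B + \<tau> (1 - B D)\<close> for the generators \<open>D\<close>, \<open>A\<close>, \<open>B\<close> with the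
  indices \<open>(i,i+1)\<close>, \<open>(i+1,i+2)\<close>, \<open>(i+1,i+3)\<close>; it determines \<open>A\<close> from \<open>D\<close> and \<open>B\<close>.\<close>

definition is_parameter :: "4 \<Rightarrow> 'a \<Rightarrow> bool"
  where "is_parameter i \<tau> \<longleftrightarrow> (\<forall>u. x (i+1) (i+2) u =
    x (i+1) (i+3) u + \<tau> *s (u - x (i+1) (i+3) (x i (i+1) u)))"

text \<open>The product of \<open>b n\<close> with a coefficient of the lowering operator \<open>(i+3,i)\<close> is
  \<open>\<phi> n\<close>.\<close>

lemma raises_nonzero:
  assumes "weight_basis scale q diameter (x i (i+1)) v"
      "weight_basis.raises scale q diameter v (x (i+1) (i+3)) b"
    and "n < diameter"
  shows "b n \<noteq> 0"
proof -
  interpret v: weight_basis scale q diameter "x i (i+1)" v by fact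
  obtain e where e: "v.lowers (x (i+3) i) e"
    using v.lowers_exists[OF gen_act_linear weyl_cycle(6)] by blast
  show ?thesis
    using v.raise_lower_product[OF gen_act_linear gen_act_linear weyl_cycle(5) assms(2) e
      assms(3)]
      v.\<phi>_nonzero[OF assms(3)] by auto
qed

lemma std_index_neighbours: "std_index i (i+1)" "std_index (i+3) i"
  using mod4_cases[of i] by (auto simp: std_index_def)

lemma parameter_exists: "\<exists>\<tau>. is_parameter i \<tau>"
proof -
  obtain v where "weight_basis scale q diameter (x i (i+1)) v"
    using weight_basis_exists[OF std_index_neighbours(1)] by blast
  then interpret v: weight_basis scale q diameter "x i (i+1)" v .
  obtain a b where ab: "v.raises (x (i+1) (i+2)) a" "v.raises (x (i+1) (i+3)) b"
    using v.raises_exists[OF gen_act_linear weyl_cycle(1)]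
      v.raises_exists[OF gen_act_linear weyl_cycle(4)] by blast
  have "b n \<noteq> 0" if "n < diameter" for n
    by (rule raises_nonzero[OF v.weight_basis_axioms ab(2) that])
  then obtain \<tau> where "\<forall>n<diameter. a n = b n * (1 - \<tau> * v.\<theta> n)"
    using v.raises_ratio[OF gen_act_linear gen_act_linear ab _ twisted_relation(1)] by blast
  from v.raises_affine[OF gen_act_linear gen_act_linear ab this]
  show ?thesis unfolding is_parameter_def by blast
qed

lemma parameter_consecutive:
  assumes "is_parameter i \<tau>" "is_parameter (i+1) \<sigma>"
  shows "\<tau> * \<sigma> * q\<^sup>2 = 1"
proof -
  obtain v where "weight_basis scale q diameter (x i (i+1)) v"
    using weight_basis_exists[OF std_index_neighbours(1)] by blast
  then interpret v: weight_basis scale q diameter "x i (i+1)" v .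
  obtain b c where bc: "v.raises (x (i+1) (i+3)) b" "v.lowers (x (i+2) i) c"
    using v.raises_exists[OF gen_act_linear weyl_cycle(4)]
      v.lowers_exists[OF gen_act_linear weyl_cycle(3)] by blast
  show ?thesis
  proof (rule v.parameter_product[OF diameter_pos gen_act_linear gen_act_linear gen_act_linear
    weyl_cycle(4) weyl_cycle(2) bc])
    show "b n \<noteq> 0" if "n < diameter" for n
      by (rule raises_nonzero[OF v.weight_basis_axioms bc(1) that])
    show "x (i+1) (i+2) u = x (i+1) (i+3) u + \<tau> *s (u - x (i+1) (i+3) (x i (i+1) u))" for u
      using assms(1) by (simp add: is_parameter_def)
    show "x (i+2) (i+3) u = x (i+2) i u + \<sigma> *s (u - x (i+2) i (x (i+1) (i+2) u))" for u
      using assms(2) unfolding is_parameter_def mod4_add by blast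
  qed (rule twisted_relation(2))
qed

text \<open>If \<open>\<sigma>\<close> is a parameter of \<open>i+1\<close>, then every parameter of \<open>i\<close> and of \<open>i+2\<close> is the
  inverse of \<open>\<sigma> * q\<^sup>2\<close>.\<close>

lemma parameter_antipodal:
  assumes "is_parameter i \<tau>"
  shows "is_parameter (i+2) \<tau>"
proof -
  obtain \<sigma> \<rho> where \<sigma>: "is_parameter (i+1) \<sigma>" and \<rho>: "is_parameter (i+2) \<rho>"
    using parameter_exists by metis
  have "\<tau> * \<sigma> * q\<^sup>2 = 1" by (rule parameter_consecutive[OF assms \<sigma>])
  moreover have "\<sigma> * \<rho> * q\<^sup>2 = 1" using parameter_consecutive[OF \<sigma>] \<rho> by (simp add: mod4_add)
  moreover have "\<rho> * (\<tau> * \<sigma> * q\<^sup>2) = \<tau> * (\<sigma> * \<rho> * q\<^sup>2)" by (simp add: mult_ac)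
  ultimately have "\<tau> = \<rho>" by simp
  then show ?thesis using \<rho> by simp
qed

text \<open>Scaling the eigenbasis such that the generator \<open>(i+1,i+3)\<close> has raising coefficients 1
  leaves no freedom: the other matrices depend only on \<open>q\<close>, the diameter and \<open>\<tau>\<close>.\<close>

lemma normal_basis_exists:
  assumes "is_parameter i \<tau>"
  obtains v where "weight_basis scale q diameter (x i (i+1)) v"
    "weight_basis.raises scale q diameter v (x (i+1) (i+3)) (\<lambda>_. 1)"
    "weight_basis.lowers scale q diameter v (x (i+2) i)
       (\<lambda>n. weight_basis.\<phi> q diameter n / (1 - \<tau> * weight_basis.\<theta> q diameter n))"
    "weight_basis.lowers scale q diameter v (x (i+3) i) (weight_basis.\<phi> q diameter)"
proof -
  obtain u where "weight_basis scale q diameter (x i (i+1)) u"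
    using weight_basis_exists[OF std_index_neighbours(1)] by blast
  then interpret u: weight_basis scale q diameter "x i (i+1)" u .
  obtain b where b: "u.raises (x (i+1) (i+3)) b"
    using u.raises_exists[OF gen_act_linear weyl_cycle(4)] by blast
  define k where "k n = (\<Prod>m<n. b m)" for n
  have k: "k n \<noteq> 0" if "n \<le> diameter" for n
    using raises_nonzero[OF u.weight_basis_axioms b] that by (auto simp: k_def)
  interpret v: weight_basis scale q diameter "x i (i+1)" "\<lambda>n. k n *s u n"
    by (rule u.weight_basis_rescale[OF k])
  have B: "v.raises (x (i+1) (i+3)) (\<lambda>_. 1)"
    by (rule u.raises_rescale[OF gen_act_linear b _ k]) (auto simp: k_def mult.commute)
  obtain c e where ce: "v.lowers (x (i+2) i) c" "v.lowers (x (i+3) i) e"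
    using v.lowers_exists[OF gen_act_linear weyl_cycle(3)]
      v.lowers_exists[OF gen_act_linear weyl_cycle(6)] by blast
  have C: "v.lowers (x (i+2) i) (\<lambda>n. v.\<phi> n / (1 - \<tau> * v.\<theta> n))"
    by (rule v.lowers_normalised[OF gen_act_linear gen_act_linear gen_act_linear weyl_cycle(2) B
      ce(1)])
      (use assms in \<open>simp add: is_parameter_def\<close>)
  have "e n = v.\<phi> n" if "n < diameter" for n
    using v.raise_lower_product[OF gen_act_linear gen_act_linear weyl_cycle(5) B ce(2) that] by simp
  then have "v.lowers (x (i+3) i) v.\<phi>" using ce(2) by (simp add: v.lowers_def)
  from that[OF v.weight_basis_axioms B C this] show ?thesis .
qed

section \<open>Existence of an exchanger\<close>

text \<open>The normal bases for \<open>i\<close> and \<open>i+2\<close> exist for the same \<open>\<tau>\<close>, so mapping one to the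
  other intertwines \<open>D\<close>, \<open>B\<close> and \<open>C\<close> with their antipodes. The inverses of \<open>B\<close> and \<open>C\<close> follow,
  and the three generators left over are obtained in the order \<open>A\<close>, \<open>F\<close>, \<open>E\<close> from the identities
  with the parameters of \<open>i\<close>, \<open>i+1\<close> and \<open>i+2\<close>.\<close>

lemma antipodal_intertwiner:
  obtains Y where "Vector_Spaces.linear scale scale Y" "bij Y"
    "\<And>j k u. std_index j k \<Longrightarrow> Y (x j k u) = x (j + 2) (k + 2) (Y u)"
proof -
  fix i :: 4
  obtain \<tau> \<sigma> where \<tau>: "is_parameter i \<tau>" and \<sigma>: "is_parameter (i+1) \<sigma>"
    using parameter_exists by metis
  have \<tau>': "is_parameter (i+2) \<tau>" and \<sigma>': "is_parameter (i+3) \<sigma>"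
    using parameter_antipodal[OF \<tau>] parameter_antipodal[OF \<sigma>] by (simp_all add: mod4_add)
  obtain v where v: "weight_basis scale q diameter (x i (i+1)) v"
    "weight_basis.raises scale q diameter v (x (i+1) (i+3)) (\<lambda>_. 1)"
    "weight_basis.lowers scale q diameter v (x (i+2) i)
       (\<lambda>n. weight_basis.\<phi> q diameter n / (1 - \<tau> * weight_basis.\<theta> q diameter n))"
    by (rule normal_basis_exists[OF \<tau>])
  obtain w where w: "weight_basis scale q diameter (x (i+2) (i+3)) w"
    "weight_basis.raises scale q diameter w (x (i+3) (i+1)) (\<lambda>_. 1)"
    "weight_basis.lowers scale q diameter w (x i (i+2))
       (\<lambda>n. weight_basis.\<phi> q diameter n / (1 - \<tau> * weight_basis.\<theta> q diameter n))"
    by (rule normal_basis_exists[OF \<tau>', unfolded mod4_add])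
  interpret v: weight_basis scale q diameter "x i (i+1)" v by (rule v)
  interpret w: weight_basis scale q diameter "x (i+2) (i+3)" w by (rule w)
  obtain Y where Y: "Vector_Spaces.linear scale scale Y" "bij Y"
      "\<And>n. n \<le> diameter \<Longrightarrow> Y (v n) = w n"
    using v.basis_map[OF w(1)] by blast
  interpret Y: Vector_Spaces.linear scale scale Y by (rule Y(1))
  have D: "Y (x i (i+1) u) = x (i+2) (i+3) (Y u)" for u
    by (rule v.intertwineI[OF Y(1) gen_act_linear gen_act_linear])
      (simp add: v.D_v w.D_v Y(3) Y.scale)
  have B: "Y (x (i+1) (i+3) u) = x (i+3) (i+1) (Y u)" for u
    by (rule v.intertwine_raises[OF w(1) Y(1,3) gen_act_linear gen_act_linear v(2) w(2)])
  have C: "Y (x (i+2) i u) = x i (i+2) (Y u)" for u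
    by (rule v.intertwine_lowers[OF w(1) Y(1,3) gen_act_linear gen_act_linear v(3) w(3)])
  have B': "Y (x (i+3) (i+1) u) = x (i+1) (i+3) (Y u)" for u
    using B[of "x (i+3) (i+1) u"] by (metis diagonal_inverse(3,4))
  have C': "Y (x i (i+2) u) = x (i+2) i (Y u)" for u
    using C[of "x i (i+2) u"] by (metis diagonal_inverse(1,2))
  have A: "Y (x (i+1) (i+2) u) = x (i+3) i (Y u)" for u
    using \<tau> \<tau>' by (simp add: is_parameter_def mod4_add Y.add Y.diff Y.scale B D)
  have F: "Y (x (i+2) (i+3) u) = x i (i+1) (Y u)" for u
    using \<sigma> \<sigma>' by (simp add: is_parameter_def mod4_add Y.add Y.diff Y.scale A C)
  have E: "Y (x (i+3) i u) = x (i+1) (i+2) (Y u)" for u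
    using \<tau> \<tau>' by (simp add: is_parameter_def mod4_add Y.add Y.diff Y.scale B' F)
  have "Y (x j k u) = x (j + 2) (k + 2) (Y u)" if "std_index j k" for j k u
  proof -
    have "j = i \<or> j = i + 1 \<or> j = i + 2 \<or> j = i + 3"
      using mod4_cases[of "j - i"] by (auto simp: algebra_simps)
    moreover have "k = j + 1 \<or> k = j + 2" using that by (auto simp: std_index_def algebra_simps)
    ultimately show ?thesis by (elim disjE) (simp_all add: mod4_add A B B' C C' D E F)
  qed
  from that[OF Y(1,2) this] show ?thesis .
qed

abbreviation endo :: "('b \<Rightarrow> 'b) \<Rightarrow> bool" where "endo \<equiv> Vector_Spaces.linear scale scale"

lemma exchanger_iff:
  "exchanger X \<longleftrightarrow> endo X \<and> bij X \<and> (\<forall>i j u. std_index i j \<longrightarrow> X (x i j u) = x (i + 2) (j + 2) (X u))"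
proof -
  have "X \<circ> x i j \<circ> inv_into UNIV X = T \<longleftrightarrow> (\<forall>u. X (x i j u) = T (X u))" if "bij X" for i j T
  proof (intro iffI allI ext)
    fix u
    assume "X \<circ> x i j \<circ> inv_into UNIV X = T"
    from fun_cong[OF this, of "X u"] show "X (x i j u) = T (X u)"
      using bij_is_inj[OF that] by simp
  next
    fix u
    assume "\<forall>u. X (x i j u) = T (X u)"
    then show "(X \<circ> x i j \<circ> inv_into UNIV X) u = T u"
      using bij_is_surj[OF that] by (simp add: surj_f_inv_f)
  qed
  then show ?thesis unfolding exchanger_def by blast
qed

lemma exchanger_exists: "\<exists>Y. exchanger Y"
proof -
  obtain Y where "endo Y" "bij Y" "\<And>j k u. std_index j k \<Longrightarrow> Y (x j k u) = x (j + 2) (k + 2) (Y u)"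
    using antipodal_intertwiner by blast
  then show ?thesis by (auto simp: exchanger_iff)
qed

lemma exchanger_scaled:
  assumes "exchanger Y" "c \<noteq> 0" "\<And>u. X u = c *s Y u"
  shows "exchanger X"
proof -
  have Y: "endo Y" "bij Y" "\<And>i j u. std_index i j \<Longrightarrow> Y (x i j u) = x (i + 2) (j + 2) (Y u)"
    using assms by (auto simp: exchanger_iff)
  interpret Y: Vector_Spaces.linear scale scale Y by (rule Y)
  have "endo X" by unfold_locales (simp_all add: assms(3) Y.add Y.scale algebra_simps)
  moreover have "bij X"
  proof (rule bijI)
    show "inj X" using bij_is_inj[OF Y(2)] assms(2) by (auto simp: inj_def assms(3))
    have "X (inv_into UNIV Y (inverse c *s u)) = u" for u
      using assms(2) by (simp add: assms(3) bij_is_surj[OF Y(2)] surj_f_inv_f)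
    then show "surj X" by (rule surjI)
  qed
  moreover have "X (x i j u) = x (i + 2) (j + 2) (X u)" if "std_index i j" for i j u
  proof -
    interpret T: Vector_Spaces.linear scale scale "x (i + 2) (j + 2)" by (rule gen_act_linear)
    show ?thesis by (simp add: assms(3) Y(3)[OF that] T.scale)
  qed
  ultimately show ?thesis by (simp add: exchanger_iff)
qed

lemma exchanger_decomp:
  assumes "exchanger X" "i \<noteq> j" "u \<in> decomp i j n"
  shows "X u \<in> decomp (i + 2) (j + 2) n"
proof -
  have X: "endo X" "\<And>i j u. std_index i j \<Longrightarrow> X (x i j u) = x (i + 2) (j + 2) (X u)"
    using assms by (auto simp: exchanger_iff)
  interpret X: Vector_Spaces.linear scale scale X by (rule X)
  show ?thesis
  proof (cases "std_index i j")
    case True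
    then show ?thesis using assms(3) X(2)[OF True, of u, symmetric]
      by (simp add: decomp_def std_index_add2 eigenspace_def X.scale)
  next
    case False
    then have "std_index j i" using std_index_flip assms(2) by blast
    then show ?thesis using assms(3) False X(2)[of j i u, symmetric]
      by (simp add: decomp_def std_index_add2 eigenspace_def X.scale)
  qed
qed

section \<open>Uniqueness and existence of [i,j,k,l]-bases\<close>

text \<open>Both branches of the definition of a decomposition consist of eigenspaces of one operator
  for distinct eigenvalues. Hence vectors from different components are independent.\<close>

lemma decomp_eigenspaces:
  assumes "i \<noteq> j"
  obtains T c where "endo T" "inj_on c {..diameter}"
      "\<And>n. n \<le> diameter \<Longrightarrow> decomp i j n = eigenspace T (c n)"
proof -
  have inj: "m = n" if "q powi (int diameter - 2 * int m) = q powi (int diameter - 2 * int n)"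
    for m n
  proof -
    obtain v where "weight_basis scale q diameter (x i (i+1)) v"
      using weight_basis_exists[OF std_index_neighbours(1)] by blast
    then interpret v: weight_basis scale q diameter "x i (i+1)" v .
    show ?thesis using that v.\<theta>_inj by (simp add: q_powi_diameter v.\<theta>_def)
  qed
  show ?thesis
  proof (cases "std_index i j")
    case True
    show ?thesis
      by (rule that[of "x i j" "\<lambda>n. q powi (int diameter - 2 * int n)"])
        (auto simp: gen_act_linear decomp_def True intro!: inj_onI dest: inj)
  next
    case False
    show ?thesis
      by (rule that[of "x j i" "\<lambda>n. q powi (int diameter - 2 * int (diameter - n))"])
        (auto simp: gen_act_linear decomp_def False intro!: inj_onI dest: inj)
  qed
qed

lemma subspace_decomp: "subspace (decomp i j n)"
proof -
  have "subspace (eigenspace (x k l) c)" for k l c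
  proof -
    interpret T: Vector_Spaces.linear scale scale "x k l" by (rule gen_act_linear)
    show ?thesis unfolding eigenspace_def subspace_def
      by (auto simp: T.zero T.add T.scale scale_right_distrib mult.commute)
  qed
  then show ?thesis by (simp add: decomp_def)
qed

lemma flag_0: "flag j 0 = decomp j (j+1) 0"
  by (simp add: flag_def span_eq_iff subspace_decomp)

lemma flag_0_line:
  assumes "u \<in> flag j 0" "u \<noteq> 0" "w \<in> flag j 0"
  shows "\<exists>c. w = c *s u"
proof -
  have jj: "j \<noteq> j + 1" by simp
  obtain B where B: "B \<subseteq> flag j 0" "independent B" "flag j 0 \<subseteq> span B" "card B = dim (flag j 0)"
    by (rule basis_exists)
  have "card B = 1" using B(4) decomp_dim[OF jj, of 0] by (simp add: flag_0)
  then obtain b where "B = {b}" by (auto simp: card_1_singleton_iff)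
  then have "flag j 0 \<subseteq> range (\<lambda>k. k *s b)" using B(3) by (simp add: span_singleton)
  then obtain k l where kl: "u = k *s b" "w = l *s b" using assms by blast
  then have "w = (l / k) *s u" using assms(2) by simp
  then show ?thesis by blast
qed

lemma ijkl_basis_sum_nonzero:
  assumes "ijkl_basis i j k l vs"
  shows "(\<Sum>n\<le>diameter. vs ! n) \<noteq> 0"
proof
  assume "(\<Sum>n\<le>diameter. vs ! n) = 0"
  moreover have vs: "length vs = diameter + 1" "distinct vs" "independent (set vs)"
    using assms by (auto simp: ijkl_basis_def)
  moreover have "(\<Sum>n\<le>diameter. vs ! n) = sum_list vs"
    by (simp add: sum_list_sum_nth vs(1) atLeast0LessThan lessThan_Suc_atMost)
  moreover have "sum_list vs = (\<Sum>v\<in>set vs. 1 *s v)"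
    using vs(2) by (simp add: sum_list_distinct_conv_sum_set[of vs id, simplified])
  ultimately have "(\<Sum>v\<in>set vs. (\<lambda>_. 1) v *s v) = 0" by simp
  moreover have "vs ! 0 \<in> set vs" using vs(1) by simp
  ultimately have "(1::'a) = 0"
    using independentD[OF vs(3), of "set vs" "\<lambda>_. 1" "vs ! 0"] by simp
  then show False by simp
qed

text \<open>The two sums lie on one line, say with ratio \<open>c\<close>. Comparing the components of
  these sums in the decomposition \<open>[k,l]\<close>, which is direct, shows that \<open>c\<close> relates the bases
  term by term.\<close>

lemma ijkl_basis_unique:
  assumes vs: "ijkl_basis i j k l vs" and ws: "ijkl_basis i j k l ws"
  obtains c where "c \<noteq> 0" "ws = map (scale c) vs"
      "(\<Sum>n\<le>diameter. ws ! n) = c *s (\<Sum>n\<le>diameter. vs ! n)"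
proof -
  obtain c where c: "(\<Sum>n\<le>diameter. ws ! n) = c *s (\<Sum>n\<le>diameter. vs ! n)"
    using flag_0_line[OF _ ijkl_basis_sum_nonzero[OF vs]] vs ws unfolding ijkl_basis_def by blast
  have "k \<noteq> l" using vs by (simp add: ijkl_basis_def)
  then obtain T e where T: "endo T" "inj_on e {..diameter}"
      "\<And>n. n \<le> diameter \<Longrightarrow> decomp k l n = eigenspace T (e n)"
    using decomp_eigenspaces by blast
  interpret T: Vector_Spaces.linear scale scale T by (rule T)
  have "ws ! n - c *s vs ! n = 0" if "n \<le> diameter" for n
  proof (rule eigenvectors_sum_zero[OF _ T(1,2)])
    show "T (ws ! n - c *s vs ! n) = e n *s (ws ! n - c *s vs ! n)" if "n \<in> {..diameter}" for n
    proof -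
      have "ws ! n \<in> eigenspace T (e n)" "vs ! n \<in> eigenspace T (e n)"
        using vs ws T(3)[of n] that by (auto simp: ijkl_basis_def)
      then show ?thesis
        by (simp add: eigenspace_def T.diff T.scale scale_right_diff_distrib mult.commute)
    qed
    show "(\<Sum>n\<le>diameter. ws ! n - c *s vs ! n) = 0"
      using c by (simp add: sum_subtractf scale_sum_right)
  qed (use that in auto)
  then have "ws = map (scale c) vs"
    using vs ws by (intro nth_equalityI) (auto simp: ijkl_basis_def)
  moreover have "c \<noteq> 0" using c ijkl_basis_sum_nonzero[OF ws] by auto
  ultimately show ?thesis using that c by blast
qed

lemma ijkl_basis_map:
  assumes "ijkl_basis i j k l vs" "endo X" "bij X" "distinct [i', j', k', l']"
    and "\<And>n u. u \<in> decomp k l n \<Longrightarrow> X u \<in> decomp k' l' n"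
    and "\<And>u. u \<in> flag j 0 \<Longrightarrow> X u \<in> flag j' 0"
  shows "ijkl_basis i' j' k' l' (map X vs)"
proof -
  interpret X: Vector_Spaces.linear scale scale X by (rule assms(2))
  have vs: "length vs = diameter + 1" "distinct vs" "independent (set vs)" "span (set vs) = UNIV"
    "\<And>n. n \<le> diameter \<Longrightarrow> vs ! n \<in> decomp k l n" "(\<Sum>n\<le>diameter. vs ! n) \<in> flag j 0"
    using assms(1) by (auto simp: ijkl_basis_def)
  have inj: "inj X" using assms(3) by (rule bij_is_inj)
  have "(\<Sum>n\<le>diameter. map X vs ! n) = X (\<Sum>n\<le>diameter. vs ! n)"
    using vs(1) by (simp add: X.sum)
  moreover have "span (set (map X vs)) = UNIV"
    using vs(4) bij_is_surj[OF assms(3)] by (simp add: X.span_image)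
  moreover have "independent (set (map X vs))"
    using X.independent_inj_image[OF vs(3) inj] by simp
  moreover have "distinct (map X vs)" using vs(2) inj by (auto simp: distinct_map inj_on_def)
  ultimately show ?thesis using vs assms(4,5,6) by (simp add: ijkl_basis_def)
qed

lemma exchanger_ijkl_basis:
  assumes "exchanger X" "ijkl_basis i j k l vs"
  shows "ijkl_basis (i + 2) (j + 2) (k + 2) (l + 2) (map X vs)"
proof (rule ijkl_basis_map[OF assms(2)])
  have kl: "k \<noteq> l" and dist: "distinct [i, j, k, l]" using assms(2) by (auto simp: ijkl_basis_def)
  show "endo X" "bij X" using assms(1) by (auto simp: exchanger_iff)
  show "distinct [i + 2, j + 2, k + 2, l + 2]" using dist by simp
  show "X u \<in> decomp (k + 2) (l + 2) n" if "u \<in> decomp k l n" for n u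
    by (rule exchanger_decomp[OF assms(1) kl that])
  show "X u \<in> flag (j + 2) 0" if "u \<in> flag j 0" for u
    using exchanger_decomp[OF assms(1), of j "j+1" u 0] that by (simp add: flag_0 mod4_add)
qed

lemma ijkl_basis_scale:
  assumes "ijkl_basis i j k l vs" "c \<noteq> 0"
  shows "ijkl_basis i j k l (map (scale c) vs)"
proof (rule ijkl_basis_map[OF assms(1)])
  show "endo (scale c)" by (rule linear_scale_self)
  show "bij (scale c)"
    by (rule o_bij[of "scale (inverse c)"]) (use assms(2) in \<open>auto simp: fun_eq_iff\<close>)
qed (use assms(1) in \<open>auto simp: ijkl_basis_def flag_0 intro: subspace_scale[OF subspace_decomp]\<close>)

text \<open>Take an eigenvector of the generator \<open>(i+3,i)\<close> that spans component 0 of the flag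
  \<open>[i+3]\<close>, and split it into its components in the decomposition \<open>[i,i+1]\<close>. They form a basis
  because none of them is zero.\<close>

lemma ijkl_basis_exists: "\<exists>vs. ijkl_basis (i+2) (i+3) i (i+1) vs"
proof -
  obtain \<tau> where "is_parameter i \<tau>" using parameter_exists by blast
  from normal_basis_exists[OF this] obtain v
    where v: "weight_basis scale q diameter (x i (i+1)) v"
      "weight_basis.lowers scale q diameter v (x (i+3) i) (weight_basis.\<phi> q diameter)" by blast
  interpret v: weight_basis scale q diameter "x i (i+1)" v by (rule v)
  obtain y where y: "\<And>n. n \<le> diameter \<Longrightarrow> y n \<noteq> 0"
    "x (i+3) i (\<Sum>n\<le>diameter. y n *s v n) = q ^ diameter *s (\<Sum>n\<le>diameter. y n *s v n)"
    using v.lowers_eigenvector[OF gen_act_linear v(2) v.\<phi>_nonzero] by blast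
  interpret y: weight_basis scale q diameter "x i (i+1)" "\<lambda>n. y n *s v n"
    by (rule v.weight_basis_rescale[OF y(1)])
  define vs where "vs = map (\<lambda>n. y n *s v n) [0..<diameter + 1]"
  have set: "set vs = (\<lambda>n. y n *s v n) ` {..diameter}"
    unfolding vs_def by (auto simp del: upt_Suc)
  have nth: "vs ! n = y n *s v n" if "n \<le> diameter" for n
    using that unfolding vs_def by (simp del: upt_Suc)
  have "(\<Sum>n\<le>diameter. vs ! n) \<in> flag (i+3) 0"
    using y(2) std_index_neighbours(2)[of i] q_powi_diameter[of 0]
    by (simp add: nth flag_0 mod4_add decomp_def eigenspace_def)
  moreover have "vs ! n \<in> decomp i (i+1) n" if "n \<le> diameter" for n
    using that y.D_v[OF that] std_index_neighbours(1)[of i]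
    by (simp add: nth decomp_def eigenspace_def q_powi_diameter)
  moreover have "distinct vs"
    using y.inj_on_v by (simp add: vs_def distinct_map atLeast0LessThan lessThan_Suc_atMost
      del: upt_Suc)
  moreover have "distinct [i+2, i+3, i, i+1]" using mod4_cases[of i] by auto
  ultimately have "ijkl_basis (i+2) (i+3) i (i+1) vs"
    unfolding ijkl_basis_def set using y.independent_v y.span_v by (simp add: vs_def)
  then show ?thesis by blast
qed

text \<open>An existing \<open>[i,j,k,l]\<close>-basis can be rescaled to have sum \<open>\<eta> j\<close>, and two with that sum
  are equal, so the definite description denotes.\<close>

lemma the_basis_is_basis:
  assumes vs: "ijkl_basis i j k l vs" and \<eta>: "\<eta> j \<noteq> 0" "\<eta> j \<in> flag j 0"
  shows "ijkl_basis i j k l (the_basis \<eta> i j k l)"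
proof -
  let ?P = "\<lambda>ws. ijkl_basis i j k l ws \<and> (\<Sum>n\<le>diameter. ws ! n) = \<eta> j"
  have mem: "(\<Sum>n\<le>diameter. vs ! n) \<in> flag j 0" using vs by (simp add: ijkl_basis_def)
  obtain c where c: "\<eta> j = c *s (\<Sum>n\<le>diameter. vs ! n)"
    using flag_0_line[OF mem ijkl_basis_sum_nonzero[OF vs] \<eta>(2)] by blast
  then have "c \<noteq> 0" using \<eta>(1) by auto
  have "(\<Sum>n\<le>diameter. map (scale c) vs ! n) = \<eta> j"
    using vs c by (simp add: ijkl_basis_def scale_sum_right)
  then have P: "?P (map (scale c) vs)" using ijkl_basis_scale[OF vs \<open>c \<noteq> 0\<close>] by blast
  moreover have "ws = ws'" if "?P ws" "?P ws'" for ws ws'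
  proof -
    have ws: "ijkl_basis i j k l ws" "ijkl_basis i j k l ws'" using that by blast+
    obtain c where "ws' = map (scale c) ws" "(\<Sum>n\<le>diameter. ws' ! n) = c *s (\<Sum>n\<le>diameter. ws ! n)"
      using ijkl_basis_unique[OF ws] by blast
    then have "ws' = map (scale c) ws" "\<eta> j = c *s \<eta> j" using that by simp_all
    then have "c = 1" using \<eta>(1) by (metis scale_one scale_cancel_right)
    then show ?thesis using \<open>ws' = _\<close> by (simp add: map_idI)
  qed
  ultimately have "?P (the_basis \<eta> i j k l)"
    unfolding the_basis_def by (intro theI[where P = ?P]) blast+
  then show ?thesis by blast
qed

text \<open>Compare \<open>X\<close> with an exchanger \<open>Y\<close>: by uniqueness they differ on \<open>vs\<close>, and therefore
  everywhere, by a nonzero factor.\<close>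

lemma exchangerI_basis:
  assumes "endo X" "ijkl_basis i j k l vs" "ijkl_basis (i + 2) (j + 2) (k + 2) (l + 2) (map X vs)"
  shows "exchanger X"
proof -
  obtain Y where Y: "exchanger Y" using exchanger_exists by blast
  interpret X: Vector_Spaces.linear scale scale X by (rule assms)
  interpret Y: Vector_Spaces.linear scale scale Y using Y by (simp add: exchanger_iff)
  obtain c where c: "c \<noteq> 0" "map X vs = map (scale c) (map Y vs)"
    using ijkl_basis_unique[OF exchanger_ijkl_basis[OF Y assms(2)] assms(3)] by blast
  have "X u = c *s Y u" for u
  proof -
    have "u \<in> span (set vs)" using assms(2) by (simp add: ijkl_basis_def)
    then show ?thesis
      by (induction rule: span_induct_alt)
        (use c(2) in \<open>auto simp: X.add X.scale Y.add Y.scale scale_right_distrib mult.commute\<close>)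
  qed
  then show ?thesis by (rule exchanger_scaled[OF Y c(1)])
qed

text \<open>Since \<open>i + 2 + 2 = i\<close>, an exchanger also maps back. This supplies the basis that
  the definite description \<open>the_basis\<close> needs when only the antipodal one is given.\<close>

lemma ijkl_basis_exists_antipodal:
  assumes "ijkl_basis (i + 2) (j + 2) (k + 2) (l + 2) ws"
  shows "\<exists>vs. ijkl_basis i j k l vs"
proof -
  obtain Y where "exchanger Y" using exchanger_exists by blast
  from exchanger_ijkl_basis[OF this assms] show ?thesis by (auto simp: mod4_add)
qed

end

theorem lemma15p7:
  fixes q :: "'f::alg_closed_field"
    and scale :: "'f \<Rightarrow> 'v::ab_group_add \<Rightarrow> 'v"
    and act :: "(std_gen, 'f) free_algebra set \<Rightarrow> 'v \<Rightarrow> 'v"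
    and \<eta> :: "4 \<Rightarrow> 'v"
    and X :: "'v \<Rightarrow> 'v"
  assumes "q \<noteq> 0"
    and "\<forall>n>0. q ^ n \<noteq> 1"
    and "evaluation_module scale q act"
    and "\<forall>j. \<eta> j \<noteq> 0 \<and> \<eta> j \<in> qtet_module.flag scale q act j 0"
    and "Vector_Spaces.linear scale scale X"
  shows "(qtet_module.exchanger scale q act X \<longleftrightarrow>
           (\<forall>i j k l. distinct [i, j, k, l] \<longrightarrow>
             (\<forall>vs. qtet_module.ijkl_basis scale q act i j k l vs \<longrightarrow>
               qtet_module.ijkl_basis scale q act (i + 2) (j + 2) (k + 2) (l + 2) (map X vs)))) \<and>
         (qtet_module.exchanger scale q act X \<longleftrightarrow>
           (\<exists>i j k l. distinct [i, j, k, l] \<and>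
             qtet_module.ijkl_basis scale q act (i + 2) (j + 2) (k + 2) (l + 2)
               (map X (qtet_module.the_basis scale q act \<eta> i j k l))))"
proof -
  interpret evaluation_module scale q act by fact
  interpret generic_evaluation_module scale q act
    by unfold_locales (use assms(1,2) in auto)
  obtain vs where vs: "ijkl_basis (0 + 2) (0 + 3) 0 (0 + 1) vs" using ijkl_basis_exists by blast
  then have dist: "distinct [0 + 2, 0 + 3, 0, 0 + 1 :: 4]" unfolding ijkl_basis_def by blast
  have \<eta>: "\<eta> j \<noteq> 0" "\<eta> j \<in> flag j 0" for j using assms(4) by auto
  show ?thesis
  proof (intro conjI iffI allI impI)
    fix i j k l :: 4 and us
    assume "exchanger X" "ijkl_basis i j k l us"
    then show "ijkl_basis (i + 2) (j + 2) (k + 2) (l + 2) (map X us)"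
        by (rule exchanger_ijkl_basis)
  next
    assume *: "\<forall>i j k l. distinct [i, j, k, l] \<longrightarrow> (\<forall>vs. ijkl_basis i j k l vs \<longrightarrow>
      ijkl_basis (i + 2) (j + 2) (k + 2) (l + 2) (map X vs))"
    show "exchanger X" by (rule exchangerI_basis[OF assms(5) vs]) (use * dist vs in blast)
  next
    assume "exchanger X"
    from exchanger_ijkl_basis[OF this the_basis_is_basis[OF vs, of \<eta>, OF \<eta>]] dist
    show "\<exists>i j k l. distinct [i, j, k, l] \<and>
      ijkl_basis (i + 2) (j + 2) (k + 2) (l + 2) (map X (the_basis \<eta> i j k l))"
      by blast
  next
    assume "\<exists>i j k l. distinct [i, j, k, l] \<and>
      ijkl_basis (i + 2) (j + 2) (k + 2) (l + 2) (map X (the_basis \<eta> i j k l))"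
    then obtain i j k l where 1:
        "ijkl_basis (i + 2) (j + 2) (k + 2) (l + 2) (map X (the_basis \<eta> i j k l))"
      by blast
    obtain us where "ijkl_basis i j k l us" using ijkl_basis_exists_antipodal[OF 1] by blast
    from exchangerI_basis[OF assms(5) the_basis_is_basis[OF this, of \<eta>, OF \<eta>] 1]
        show "exchanger X" .
  qed
qed

end
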